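(* Let $p$ be a prime and $t$ an integer, and suppose that either $p\geq 5$ and $t\geq 2$, or $p=3$ and $t\geq 3$. Let $\mathcal S(\mathbb Z_{p^t})$ denote the set of all determinants of $p^t\times p^t$ circulant matrices with integer entries. Then $p^{2t}\mathbb Z\subseteq \mathcal S(\mathbb Z_{p^t})$, but $p^j\notin \mathcal S(\mathbb Z_{p^t})$ for every integer $j$ with $t+1\leq j\leq 2t-1$. Moreover, suppose that $p^j m\in \mathcal S(\mathbb Z_{p^t})$ where $m$ is an integer with $p\nmid m$ and $t+1\leq j\leq 2t-1$. (a) If $p\geq 5$, or $p=3$ and $j>t+1$, then there exist $2t-j$ prime powers $q_1^{a_1},\dots,q_{2t-j}^{a_{2t-j}}$ (each $q_i$ prime) with $q_i^{a_i}\equiv 1 \pmod{p^i}$ and each $a_i$ odd, such that $\prod_{i=1}^{2t-j} q_i^{a_i}$ divides $m$. (b) If $p=3$ and $j=t+1$, then there exist $t-2$ prime powers $q_2^{a_2},\dots,q_{t-1}^{a_{t-1}}$ (each $q_i$ prime) with $q_i^{a_i}\equiv 1 \pmod{3^i}$ and each $a_i$ odd, such that $\prod_{i=2}^{t-1} q_i^{a_i}$ divides $m$.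
   Context: A circulant matrix with first row $(a_0,\dots,a_{n-1})$ has $(r,s)$ entry $a_{(s-r)\bmod n}$. Its determinant equals $M_n(F)=\prod_{z^n=1}F(z)$ where $F(x)=\sum_{j=0}^{n-1}a_jx^j$; so $\mathcal S(\mathbb Z_n)=\{M_n(F): F\in\mathbb Z[x]\}$. *)

theory Defs
  imports "Jordan_Normal_Form.Determinant" "HOL-Computational_Algebra.Primes" "HOL-Number_Theory.Cong"
begin

definition circulant :: "nat \<Rightarrow> (nat \<Rightarrow> int) \<Rightarrow> int mat" where
  "circulant n a = mat n n (\<lambda>(r, s). a ((s + n - r) mod n))"

definition circ_dets :: "nat \<Rightarrow> int set" where
  "circ_dets n = {det (circulant n a) | a. True}"

end

theory Submission
  imports Defs "HOL-Number_Theory.Number_Theory"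
begin

text \<open>Let $F(x)=\sum_j a_jx^j$, so that the determinant is $F(1)\prod_{i=1}^t N_i$, where $N_i$ is the product of
  $F$ over the primitive $p^i$-th roots of unity. If $p$ divides the determinant to a power less than $2t+1$,
  expanding $F$ around $1$ shows that $p$ divides every $N_i$ exactly once, so that $p^{j-t}$ exactly divides $F(1)$.
  Suppose that $N_i/p$ has no divisor $q^a\equiv 1\pmod{p^i}$ with $q$ prime and $a$ odd. Then all its prime
  divisors have even order modulo $p^i$, so complex conjugation is a Frobenius power locally at each of them and
  preserves the ideal generated by $F(\zeta)$. Hence $F(\bar\zeta)=\varepsilon F(\zeta)$ with $\varepsilon$ of
  absolute value $1$ at all conjugates, which gives $F(\bar\zeta)=-\zeta^cF(\zeta)$. If this happens at all levels $i\in B$,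
  then one exponent $c$ serves them all (up to an exception at $p=3$, $i=1$), the product of the cyclotomic
  polynomials $\Phi_{p^i}$, $i\in B$, divides $F(x^{-1})+x^cF(x)$, and evaluation at $1$ shows that $p^{|B|}$ divides $2F(1)$.
  So at most $j-t$ levels are exceptional, and the others provide the required prime powers.\<close>

hide_const (open) up_ring.monom up_ring.coeff

text \<open>An element of the ring Z[zeta] is handled together with all its conjugates, as a
  function on the primitive p^i-th roots of unity given by an integer polynomial. Automorphisms are
  then substitutions of z^a for z, and ideals enter only through congruences modulo rational
  integers: the local argument at the primes above q becomes a congruence modulo q^K.

  Odd exponents arise because q^f divides the norm, where f is the order of q modulo p^i, and an
  even f would make q^(f/2) congruent to -1, which is complex conjugation.

  The exception at p = 3 is numerical. Exponents from two levels are compared through the norm of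
  z^c - z^c', at most 2^d for d primitive roots, against p^(d-1). This fails only for p = 3, d = 2,
  that is at level 1, where 4 > 3. Two higher levels repair it (4 < 27), which is why j > t+1
  rescues (a), while (b) leaves level 1 out.

  Only the number of good levels is known, not which ones they are. Matching each index i with a
  good level l \<ge> i weakens the congruence to p^i, which explains the moduli in the statement.
  The case m = 1 excludes p^j itself.\<close>

section \<open>Evaluation of integer polynomials at complex numbers\<close>

definition ev :: "int poly \<Rightarrow> complex \<Rightarrow> complex" where
  "ev F z = poly (map_poly of_int F) z"

lemma ev_0 [simp]: "ev 0 z = 0" and ev_1 [simp]: "ev 1 z = 1"
  by (simp_all add: ev_def)

lemma ev_pCons [simp]: "ev (pCons a F) z = of_int a + z * ev F z"
  by (simp add: ev_def map_poly_pCons)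

lemma ev_smult [simp]: "ev (smult a F) z = of_int a * ev F z"
  by (induction F) (simp_all add: algebra_simps)

lemma ev_add [simp]: "ev (F + G) z = ev F z + ev G z"
  by (induction F G rule: poly_induct2) (simp_all add: algebra_simps)

lemma ev_uminus [simp]: "ev (- F) z = - ev F z"
  by (induction F) simp_all

lemma ev_diff [simp]: "ev (F - G) z = ev F z - ev G z"
  using ev_add[of F "- G" z] by simp

lemma ev_mult [simp]: "ev (F * G) z = ev F z * ev G z"
  by (induction F) (simp_all add: algebra_simps)

lemma ev_power [simp]: "ev (F ^ k) z = ev F z ^ k"
  by (induction k) simp_all

lemma ev_sum [simp]: "ev (\<Sum>x\<in>A. F x) z = (\<Sum>x\<in>A. ev (F x) z)"
  by (induction A rule: infinite_finite_induct) simp_all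

lemma ev_prod [simp]: "ev (\<Prod>x\<in>A. F x) z = (\<Prod>x\<in>A. ev (F x) z)"
  by (induction A rule: infinite_finite_induct) simp_all

lemma ev_monom [simp]: "ev (monom a k) z = of_int a * z ^ k"
  by (induction k) (simp_all add: monom_0 monom_Suc)

lemma ev_pcompose [simp]: "ev (pcompose F G) z = ev F (ev G z)"
  by (induction F) (simp_all add: pcompose_pCons)

lemma ev_of_int [simp]: "ev F (of_int a) = of_int (poly F a)"
  by (induction F) simp_all

lemma ev_one_arg: "ev F 1 = of_int (poly F 1)"
  using ev_of_int[of F 1] by simp

lemma ev_cnj: "ev F (cnj z) = cnj (ev F z)"
  by (induction F) simp_all

lemma ev_eq_sum: "ev F z = (\<Sum>k\<le>degree F. of_int (coeff F k) * z ^ k)"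
  by (simp add: ev_def poly_altdef coeff_map_poly degree_map_poly)

section \<open>Complex roots of unity and division by monic integer polynomials\<close>

lemma norm_root_of_unity:
  fixes z :: complex
  assumes "z ^ n = 1" "n > 0"
  shows "norm z = 1"
proof -
  have "norm z ^ n = 1 ^ n" using assms(1) by (simp flip: norm_power)
  then show ?thesis using assms(2) by (meson norm_ge_zero power_eq_imp_eq_base zero_le_one)
qed

lemma cnj_root_of_unity:
  fixes z :: complex
  assumes "z ^ n = 1" "n > 0"
  shows "cnj z = z ^ (n - 1)"
proof -
  have "z * cnj z = 1"
    using norm_root_of_unity[OF assms] by (simp add: complex_norm_square[symmetric])
  moreover have "z * z ^ (n - 1) = 1"
    using assms by (metis power_minus_mult mult.commute)
  moreover have "z \<noteq> 0" using assms by (metis power_eq_0_iff zero_neq_one)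
  ultimately show ?thesis by (metis mult_cancel_left)
qed

lemma monic_division:
  fixes P W :: "int poly"
  assumes "lead_coeff W = 1"
  obtains Q R where "P = W * Q + R" "R = 0 \<or> degree R < degree W"
proof -
  obtain Q R where qr: "pseudo_divmod P W = (Q, R)" by force
  have "W \<noteq> 0" using assms by auto
  from pseudo_divmod[OF this qr] assms that show thesis by auto
qed

text \<open>Subtracting c leaves a polynomial with more zeros than its degree allows, so it is zero;
  comparing constant coefficients then shows that c is an integer. This is the source of every
  integrality statement about norms.\<close>

lemma ev_eq_const_imp:
  assumes "finite S" "R = 0 \<or> degree R < card S" "\<And>z. z \<in> S \<Longrightarrow> ev R z = c"
    and "S \<noteq> {}"
  shows "R = [:coeff R 0:] \<and> c = of_int (coeff R 0)"
proof -
  define T where "T = map_poly of_int R - [:c:]"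
  have "T = 0"
  proof (rule ccontr)
    assume T: "T \<noteq> 0"
    have "S \<subseteq> {z. poly T z = 0}"
      using assms(3) by (auto simp: T_def ev_def)
    then have "card S \<le> card {z. poly T z = 0}"
      by (rule card_mono[OF poly_roots_finite[OF T]])
    also have "\<dots> \<le> degree T" by (rule card_poly_roots_bound[OF T])
    also have "degree T \<le> degree R"
      unfolding T_def by (rule degree_diff_le) (simp_all add: degree_map_poly)
    finally have "R = 0" using assms(2) by auto
    then have "degree T = 0" by (simp add: T_def)
    with \<open>card {z. poly T z = 0} \<le> degree T\<close> \<open>card S \<le> card {z. poly T z = 0}\<close>
    show False using assms(1,4) by simp
  qed
  then have *: "map_poly of_int R = [:c:]" by (simp add: T_def)
  then have "degree R = 0"
    by (metis degree_map_poly of_int_eq_0_iff degree_pCons_0)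
  moreover have "of_int (coeff R 0) = c"
    using arg_cong[OF *, of "\<lambda>P. coeff P 0"] by (simp add: coeff_map_poly)
  ultimately show ?thesis
    by (metis degree_0_id)
qed

text \<open>Division by a monic polynomial stays inside Z[x], and the remainder has more zeros than
  its degree allows.\<close>

lemma monic_dvd_if_vanishes:
  assumes "lead_coeff W = 1" "finite S" "card S = degree W"
    and "\<And>z. z \<in> S \<Longrightarrow> ev W z = 0" "\<And>z. z \<in> S \<Longrightarrow> ev P z = 0"
  shows "W dvd P"
proof (cases "S = {}")
  case True
  then have "degree W = 0" using assms by simp
  then have "W = 1" using assms(1) by (metis degree_0_id one_pCons)
  then show ?thesis by simp
next
  case False
  obtain Q R where QR: "P = W * Q + R" "R = 0 \<or> degree R < degree W"
    using monic_division[OF assms(1)] by metis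
  have "ev R z = 0" if "z \<in> S" for z
    using assms(4,5)[OF that] QR(1) by simp
  then have "R = 0"
    using ev_eq_const_imp[OF assms(2), of R 0] QR(2) False assms(3) by (metis of_int_eq_0_iff pCons_0_0)
  then show ?thesis using QR by simp
qed

lemma primitive_root_of_unity:
  assumes "N > 0"
  obtains w :: complex where "w ^ N = 1" "bij_betw (\<lambda>k. w ^ k) {..<N} {z. z ^ N = 1}"
proof
  define w where "w = cis (2 * pi / of_nat N)"
  have "(\<lambda>l. w ^ l) = (\<lambda>k. cis (2 * pi * real k / real N))"
    by (simp add: w_def DeMoivre mult_ac)
  then show "bij_betw (\<lambda>k. w ^ k) {..<N} {z. z ^ N = 1}"
    using bij_betw_roots_unity[OF assms] by simp
  show "w ^ N = 1" using assms by (simp add: w_def DeMoivre)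
qed

section \<open>Prime powers modulo a prime, expansion at 1, and cosets of powers\<close>

lemma binomial_prime_expansion:
  fixes x y :: complex
  assumes "prime q"
  shows "(x + y) ^ q = x ^ q + y ^ q +
    of_nat q * (\<Sum>k\<in>{1..<q}. of_nat ((q choose k) div q) * x ^ k * y ^ (q - k))"
proof -
  have q: "q > 0" using assms prime_gt_0_nat by blast
  have "(x + y) ^ q = (\<Sum>k\<le>q. of_nat (q choose k) * x ^ k * y ^ (q - k))"
    by (rule binomial_ring)
  also have "{..q} = insert 0 (insert q {1..<q})" using q by auto
  also have "(\<Sum>k\<in>\<dots>. of_nat (q choose k) * x ^ k * y ^ (q - k)) =
     y ^ q + (x ^ q + (\<Sum>k\<in>{1..<q}. of_nat (q choose k) * x ^ k * y ^ (q - k)))"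
    using q by simp
  also have "(\<Sum>k\<in>{1..<q}. of_nat (q choose k) * x ^ k * y ^ (q - k)) =
     (\<Sum>k\<in>{1..<q}. of_nat q * (of_nat ((q choose k) div q) * x ^ k * y ^ (q - k)))"
  proof (rule sum.cong)
    fix k assume "k \<in> {1..<q}"
    then have "q dvd (q choose k)" using assms by (intro dvd_choose_prime) auto
    then have "(q choose k) = q * ((q choose k) div q)" by simp
    then have "of_nat (q choose k) = (of_nat q * of_nat ((q choose k) div q) :: complex)"
      by (metis of_nat_mult)
    then show "of_nat (q choose k) * x ^ k * y ^ (q - k) =
      of_nat q * (of_nat ((q choose k) div q) * x ^ k * y ^ (q - k))" by simp
  qed simp
  finally show ?thesis by (simp add: sum_distrib_left algebra_simps)
qed

lemma int_fermat:
  assumes "prime (q :: nat)"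
  shows "int q dvd a ^ q - a"
proof -
  define b where "b = nat (a mod int q)"
  have q: "q > 0" using assms prime_gt_0_nat by blast
  have ab: "[a = int b] (mod int q)" using q by (simp add: b_def cong_def)
  have "[b ^ q = b] (mod q)"
  proof (cases "q dvd b")
    case True
    then have "q dvd b ^ q" using q by (meson dvd_power dvd_trans)
    then show ?thesis using True by (metis cong_0_iff cong_sym cong_trans)
  next
    case False
    have "[b * b ^ (q - 1) = b * 1] (mod q)"
      using fermat_theorem[OF assms False] by (intro cong_mult) auto
    then show ?thesis using q by (metis mult.commute mult_1 power_minus_mult)
  qed
  then have "[int b ^ q = int b] (mod int q)" by (metis cong_int_iff of_nat_power)
  then have "[a ^ q = a] (mod int q)"
    using ab by (meson cong_pow cong_sym cong_trans)
  then show ?thesis by (simp add: cong_iff_dvd_diff)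
qed

lemma pderiv_sum: "pderiv (\<Sum>x\<in>A. f x) = (\<Sum>x\<in>A. pderiv (f x))"
  by (induction A rule: infinite_finite_induct) (simp_all add: pderiv_add)

lemma poly_synthetic_div_1:
  fixes F :: "int poly"
  shows "poly (synthetic_div F 1) 1 = poly (pderiv F) 1"
proof -
  have "pderiv F = pderiv ([:- 1, 1:] * synthetic_div F 1 + [:poly F 1:])"
    by (simp only: synthetic_div_correct')
  then have "poly (pderiv F) 1 = poly (pderiv ([:- 1, 1:] * synthetic_div F 1 + [:poly F 1:])) 1"
    by simp
  also have "\<dots> = poly (synthetic_div F 1) 1"
    by (simp add: pderiv_mult pderiv_add pderiv_diff pderiv_pCons)
  finally show ?thesis by simp
qed

lemma ev_synthetic_div: "ev F z = (z - 1) * ev (synthetic_div F 1) z + of_int (poly F 1)"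
  using arg_cong[OF synthetic_div_correct'[of 1 F], of "\<lambda>P. ev P z"]
  by (simp add: algebra_simps)

text \<open>The exponent 1 + (q-1)(1 + q + ... + q^(f-1)) telescopes to q^f. Once q^f is 1 modulo n,
  this makes the product act as an identity on x modulo q.\<close>

lemma prod_power_power_mult:
  fixes x :: "'a :: comm_monoid_mult"
  assumes "q \<ge> 1"
  shows "x * (\<Prod>k<f. (x ^ (q ^ k)) ^ (q - 1)) = x ^ (q ^ f)"
proof (induction f)
  case (Suc f)
  have "x * (\<Prod>k<Suc f. (x ^ (q ^ k)) ^ (q - 1)) = x ^ (q ^ f) * (x ^ (q ^ f)) ^ (q - 1)"
    using Suc by (simp add: mult.assoc[symmetric])
  also have "\<dots> = (x ^ (q ^ f)) ^ q"
    using assms by (metis One_nat_def Suc_diff_le Suc_le_eq diff_Suc_1 diff_Suc_Suc power_Suc)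
  finally show ?case by (simp add: mult.commute flip: power_mult)
qed simp

text \<open>Coset representatives of the subgroup generated by q in the units modulo n, that is, of
  the decomposition group of the primes above q. Each coset is represented by its least
  residue.\<close>

lemma powers_transversal:
  assumes "coprime q n" "n > (1::nat)"
  obtains S where "S \<subseteq> totatives n"
    "bij_betw (\<lambda>(a, k). a * q ^ k mod n) (S \<times> {..<ord n q}) (totatives n)"
proof -
  define f where "f = ord n q"
  have f: "f > 0" using assms by (simp add: f_def coprime_commute)
  have qf: "[q ^ f = 1] (mod n)" unfolding f_def by (rule ord)
  have qfk: "[q ^ (f * k) = 1] (mod n)" for k
    using cong_pow[OF qf, of k] by (simp add: power_mult)
  have inv: "[c * q ^ j * q ^ ((f - 1) * j) = c] (mod n)" for c j
  proof -
    have "j + (f - 1) * j = f * j" using f by (cases f) auto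
    then have "c * q ^ j * q ^ ((f - 1) * j) = c * q ^ (f * j)"
      by (metis mult.assoc power_add)
    then show ?thesis using cong_mult[OF cong_refl qfk] by (metis mult_1_right)
  qed
  define S where "S = {a \<in> totatives n. \<forall>k. a \<le> a * q ^ k mod n}"
  have mem: "a * q ^ k mod n \<in> totatives n" if "a \<in> totatives n" for a k
  proof -
    have "coprime (a * q ^ k mod n) n"
      using that assms(1) by (simp add: in_totatives_iff)
    moreover from this have "a * q ^ k mod n \<noteq> 0" using assms(2) by (metis coprime_0_left_iff nat_dvd_1_iff_1 less_irrefl)
    ultimately show ?thesis using assms(2) by (simp add: in_totatives_iff less_imp_le)
  qed
  have less: "a < n" if "a \<in> totatives n" for a
    using that assms(2) by (simp add: totatives_less)
  \<comment> \<open>Multiplication by q^((f-1)l) inverts q^l, so b lies in the orbit of a and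
    minimality of a applies. Used in both directions, it shows that a coset has only one
    representative.\<close>
  have le: "a \<le> b" if a: "a \<in> S" and b: "b \<in> totatives n" and e: "[b * q ^ l = a * q ^ k] (mod n)" for a b k l
  proof -
    have "[b * q ^ l * q ^ ((f - 1) * l) = a * q ^ k * q ^ ((f - 1) * l)] (mod n)"
      using e by (rule cong_mult[OF _ cong_refl])
    then have "[b = a * q ^ (k + (f - 1) * l)] (mod n)"
      using inv[of b l] by (metis cong_sym cong_trans mult.assoc power_add)
    then have "b = a * q ^ (k + (f - 1) * l) mod n"
      using less[OF b] by (simp add: cong_def)
    then show ?thesis using a by (simp add: S_def)
  qed
  have "inj_on (\<lambda>(a, k). a * q ^ k mod n) (S \<times> {..<f})"
  proof (rule inj_onI)
    fix x y assume xy: "x \<in> S \<times> {..<f}" "y \<in> S \<times> {..<f}"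
      "(case x of (a, k) \<Rightarrow> a * q ^ k mod n) = (case y of (a, k) \<Rightarrow> a * q ^ k mod n)"
    obtain a k b l where xy_eq: "x = (a, k)" "y = (b, l)" by fastforce
    then have *: "a \<in> S" "k \<in> {..<f}" "b \<in> S" "l \<in> {..<f}" "a * q ^ k mod n = b * q ^ l mod n"
      using xy by auto
    then have "a \<in> totatives n" "b \<in> totatives n" by (auto simp: S_def)
    then have ab: "a = b" using le[of a b l k] le[of b a k l] * by (simp add: cong_def)
    then have "[a * q ^ k = a * q ^ l] (mod n)" using * by (simp add: cong_def)
    moreover have "coprime a n" using \<open>a \<in> totatives n\<close> by (simp add: in_totatives_iff)
    ultimately have "[q ^ k = q ^ l] (mod n)" by (simp add: cong_mult_lcancel_nat)
    then have "[k = l] (mod f)"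
      using assms(1) unfolding f_def by (metis coprime_commute order_divides_expdiff)
    then show "x = y" using * ab xy_eq by (simp add: cong_def)
  qed
  moreover have "(\<lambda>(a, k). a * q ^ k mod n) ` (S \<times> {..<f}) = totatives n"
  proof (intro equalityI subsetI)
    fix c assume c: "c \<in> totatives n"
    define orb where "orb = range (\<lambda>j. c * q ^ j mod n)"
    have "finite orb" by (rule finite_subset[of _ "{..<n}"]) (use assms(2) in \<open>auto simp: orb_def\<close>)
    define a where "a = Min orb"
    have "a \<in> orb" unfolding a_def using \<open>finite orb\<close> by (intro Min_in) (auto simp: orb_def)
    then obtain j where j: "a = c * q ^ j mod n" by (auto simp: orb_def)
    have aS: "a \<in> S"
    proof -
      have "a \<le> a * q ^ k mod n" for k
      proof -
        have "a * q ^ k mod n = c * q ^ (j + k) mod n"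
          by (simp add: j power_add mod_mult_left_eq mult.assoc[symmetric])
        then have "a * q ^ k mod n \<in> orb" by (auto simp: orb_def)
        then show ?thesis unfolding a_def using \<open>finite orb\<close> by simp
      qed
      then show ?thesis using mem[OF c] j by (simp add: S_def)
    qed
    define k where "k = ((f - 1) * j) mod f"
    have "[q ^ k = q ^ ((f - 1) * j)] (mod n)"
      using assms(1) unfolding k_def f_def
      by (metis coprime_commute order_divides_expdiff cong_mod_left cong_refl)
    moreover have "[a = c * q ^ j] (mod n)" using j by (simp add: cong_def)
    ultimately have "[a * q ^ k = c] (mod n)"
      using inv[of c j] by (meson cong_mult cong_trans)
    then have "c = a * q ^ k mod n" using less[OF c] by (simp add: cong_def)
    moreover have "k \<in> {..<f}" using f by (simp add: k_def)
    ultimately show "c \<in> (\<lambda>(a, k). a * q ^ k mod n) ` (S \<times> {..<f})"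
      using aS by (intro image_eqI[of _ _ "(a, k)"]) auto
  qed (use mem in \<open>auto simp: S_def\<close>)
  ultimately have "bij_betw (\<lambda>(a, k). a * q ^ k mod n) (S \<times> {..<f}) (totatives n)"
    by (simp add: bij_betw_def)
  then show thesis using that[of S] by (simp add: S_def f_def)
qed

section \<open>Orthogonality and Parseval's identity on roots of unity\<close>

lemma sum_roots_of_unity_orthogonal:
  assumes "j < N" "k < N"
  shows "(\<Sum>z | z ^ N = 1. z ^ j * cnj z ^ k) = (if j = k then of_nat N else (0 :: complex))"
proof -
  have N: "N > 0" using assms by simp
  obtain w :: complex where wN: "w ^ N = 1" and bij: "bij_betw (\<lambda>l. w ^ l) {..<N} {z. z ^ N = 1}"
    using primitive_root_of_unity[OF N] by blast
  define u where "u = w ^ j * cnj w ^ k"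
  have "(\<Sum>z | z ^ N = 1. z ^ j * cnj z ^ k) = (\<Sum>l<N. (w ^ l) ^ j * cnj (w ^ l) ^ k)"
    using sum.reindex_bij_betw[OF bij, of "\<lambda>z. z ^ j * cnj z ^ k"] by simp
  also have "\<dots> = (\<Sum>l<N. u ^ l)"
    by (simp add: u_def power_mult_distrib mult.commute flip: power_mult)
  also have "\<dots> = (if j = k then of_nat N else 0)"
  proof -
    have ww: "w * cnj w = 1"
      using norm_root_of_unity[OF wN N] by (simp add: complex_norm_square[symmetric])
    show ?thesis
    proof (cases "j = k")
      case True
      then have "u = 1" using ww by (simp add: u_def flip: power_mult_distrib)
      then show ?thesis using True by simp
    next
      case False
      have "u \<noteq> 1"
      proof
        assume "u = 1"
        then have "w ^ j * cnj w ^ k * w ^ k = w ^ k" by (simp add: u_def)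
        also have "w ^ j * cnj w ^ k * w ^ k = w ^ j * (w * cnj w) ^ k"
          by (simp add: power_mult_distrib algebra_simps)
        finally have "w ^ j = w ^ k" using ww by simp
        then show False
          using bij assms False unfolding bij_betw_def inj_on_def by blast
      qed
      moreover have "u ^ N = 1"
        using wN by (simp add: u_def power_mult_distrib mult.commute[of _ N] flip: power_mult)
          (simp add: power_mult flip: complex_cnj_power)
      ultimately have "(\<Sum>l<N. u ^ l) = 0" by (simp add: sum_gp_strict)
      then show ?thesis using False by simp
    qed
  qed
  finally show ?thesis .
qed

lemma parseval_roots_of_unity:
  fixes c :: "nat \<Rightarrow> int"
  shows "(\<Sum>z | z ^ N = 1. (cmod (\<Sum>j<N. of_int (c j) * z ^ j))\<^sup>2) = real N * (\<Sum>j<N. real_of_int ((c j)\<^sup>2))"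
proof -
  have "complex_of_real (\<Sum>z | z ^ N = 1. (cmod (\<Sum>j<N. of_int (c j) * z ^ j))\<^sup>2) =
    (\<Sum>z | z ^ N = 1. (\<Sum>j<N. of_int (c j) * z ^ j) * (\<Sum>k<N. of_int (c k) * cnj z ^ k))"
    by (simp add: complex_norm_square del: of_real_power)
  also have "\<dots> = (\<Sum>z | z ^ N = 1. \<Sum>j<N. \<Sum>k<N. of_int (c j * c k) * (z ^ j * cnj z ^ k))"
    by (simp add: sum_product algebra_simps)
  also have "\<dots> = (\<Sum>j<N. \<Sum>k<N. of_int (c j * c k) * (\<Sum>z | z ^ N = 1. z ^ j * cnj z ^ k))"
    by (subst sum.swap, rule sum.cong[OF refl], subst sum.swap) (simp add: sum_distrib_left)
  also have "\<dots> = (\<Sum>j<N. \<Sum>k<N. if j = k then of_int (c j * c k) * of_nat N else 0)"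
    by (intro sum.cong) (auto simp: sum_roots_of_unity_orthogonal)
  also have "\<dots> = complex_of_real (real N * (\<Sum>j<N. real_of_int ((c j)\<^sup>2)))"
    by (simp add: sum_distrib_left power2_eq_square algebra_simps)
  finally show ?thesis by (simp only: of_real_eq_iff)
qed

lemma sum_lessThan_mult:
  fixes g :: "nat \<Rightarrow> 'a :: comm_monoid_add"
  shows "(\<Sum>j<m * p. g j) = (\<Sum>r<m. \<Sum>l<p. g (r + m * l))"
proof (induction p)
  case (Suc p)
  have "(\<Sum>j<a + b. g j) = (\<Sum>j<a. g j) + (\<Sum>r<b. g (r + a))" for a b
    by (induction b) (simp_all add: ac_simps)
  from this[of "m * p" m] show ?case
    using Suc by (simp add: sum.distrib add.commute)
qed simp

lemma sum_squares_int_eq_1: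
  fixes c :: "'a \<Rightarrow> int"
  assumes "finite A" "(\<Sum>x\<in>A. (c x)\<^sup>2) = 1"
  obtains x where "x \<in> A" "c x = 1 \<or> c x = -1" "\<And>y. y \<in> A \<Longrightarrow> y \<noteq> x \<Longrightarrow> c y = 0"
proof -
  have "\<exists>x\<in>A. c x \<noteq> 0"
  proof (rule ccontr)
    assume "\<not> (\<exists>x\<in>A. c x \<noteq> 0)"
    then have "(\<Sum>x\<in>A. (c x)\<^sup>2) = 0" by simp
    then show False using assms(2) by simp
  qed
  then obtain x where x: "x \<in> A" "c x \<noteq> 0" by blast
  have eq: "(c x)\<^sup>2 + (\<Sum>y\<in>A - {x}. (c y)\<^sup>2) = 1"
    using assms sum.remove[OF assms(1) x(1), of "\<lambda>x. (c x)\<^sup>2"] by simp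
  have nn: "(\<Sum>y\<in>A - {x}. (c y)\<^sup>2) \<ge> 0" by (intro sum_nonneg) auto
  have "(c x)\<^sup>2 > 0" using x(2) by simp
  with eq nn have "(c x)\<^sup>2 = 1" "(\<Sum>y\<in>A - {x}. (c y)\<^sup>2) = 0" by linarith+
  moreover from this(2) have "\<forall>y\<in>A - {x}. (c y)\<^sup>2 = 0"
    using assms(1) by (subst (asm) sum_nonneg_eq_0_iff) auto
  ultimately have "c x = 1 \<or> c x = -1" "\<And>y. y \<in> A \<Longrightarrow> y \<noteq> x \<Longrightarrow> c y = 0"
    by (auto simp: power2_eq_1_iff)
  then show thesis by (rule that[OF x(1)])
qed

section \<open>Primitive roots of prime power order and their cyclotomic polynomial\<close>

text \<open>The criterion for a good level i, applied with n = p^i and N the norm of F at that level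
  divided by p.\<close>

definition odd_prime_power_divisor :: "nat \<Rightarrow> int \<Rightarrow> bool" where
  "odd_prime_power_divisor n N \<longleftrightarrow>
     (\<exists>q e. prime q \<and> odd e \<and> [q ^ e = 1] (mod n) \<and> int (q ^ e) dvd N)"

definition prim_roots :: "nat \<Rightarrow> nat \<Rightarrow> complex set" where
  "prim_roots p i = {z. z ^ (p ^ i) = 1 \<and> z ^ (p ^ (i - 1)) \<noteq> 1}"

definition cyclotomic :: "nat \<Rightarrow> nat \<Rightarrow> int poly" where
  "cyclotomic p i = (\<Sum>k<p. Polynomial.monom 1 (p ^ (i - 1) * k))"

locale prime_power_roots =
  fixes p i :: nat
  assumes prime_p: "prime p" and odd_p: "odd p" and i_pos: "i \<ge> 1"
begin

abbreviation n where "n \<equiv> p ^ i"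
abbreviation m where "m \<equiv> p ^ (i - 1)"
abbreviation Z where "Z \<equiv> prim_roots p i"

lemma p_ge_3: "p \<ge> 3"
  using prime_p odd_p prime_ge_2_nat[of p] by (cases "p = 2") auto

lemma n_eq: "n = m * p"
  using i_pos by (simp add: power_eq_if)

lemma m_pos: "m > 0"
  using prime_p prime_gt_0_nat by simp

lemma n_pos: "n > 0"
  using prime_p prime_gt_0_nat by simp

lemma Z_root: "z \<in> Z \<Longrightarrow> z ^ n = 1"
  by (simp add: prim_roots_def)

lemma Z_norm: "z \<in> Z \<Longrightarrow> norm z = 1"
  using norm_root_of_unity[OF Z_root n_pos] .

text \<open>By Bezout the exponent may be replaced by its gcd with \<open>n\<close>, a power p^j;
  here j < i would make z an \<open>m\<close>-th root of unity.\<close>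

lemma Z_power_eq_1_iff:
  assumes "z \<in> Z"
  shows "z ^ k = 1 \<longleftrightarrow> n dvd k"
proof
  assume zk: "z ^ k = 1"
  show "n dvd k"
  proof (cases "k = 0")
    case False
    then obtain x y where xy: "k * x = n * y + gcd k n"
      using bezout_nat[of k n] by blast
    have "z ^ (k * x) = 1" using zk by (simp add: power_mult)
    moreover have "z ^ (n * y) = 1" using Z_root[OF assms] by (simp add: power_mult)
    ultimately have g1: "z ^ gcd k n = 1" using xy by (simp add: power_add)
    have "gcd k n dvd p ^ i" by simp
    then obtain j where j: "j \<le> i" "gcd k n = p ^ j"
      using divides_primepow_nat[OF prime_p] by blast
    show ?thesis
    proof (cases "j = i")
      case True
      then show ?thesis using j by (metis gcd_dvd1)
    next
      case False
      then have "p ^ j dvd m" using j by (intro le_imp_power_dvd) auto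
      then obtain c where "m = p ^ j * c" by blast
      then have "z ^ m = 1" using g1 j by (simp add: power_mult)
      then show ?thesis using assms by (simp add: prim_roots_def)
    qed
  qed simp
next
  assume "n dvd k"
  then show "z ^ k = 1" using Z_root[OF assms] by (auto simp: power_mult)
qed

lemma Z_nonzero: "z \<in> Z \<Longrightarrow> z \<noteq> 0"
  using Z_norm by force

lemma Z_power_eq_iff:
  assumes "z \<in> Z"
  shows "z ^ a = z ^ b \<longleftrightarrow> [a = b] (mod n)"
proof -
  have *: "z ^ a = z ^ b \<longleftrightarrow> [a = b] (mod n)" if "a \<le> b" for a b
  proof -
    have "z ^ a = z ^ b \<longleftrightarrow> z ^ (b - a) = 1"
      using that Z_nonzero[OF assms] by (auto simp: power_diff)
    also have "\<dots> \<longleftrightarrow> n dvd (b - a)" by (rule Z_power_eq_1_iff[OF assms])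
    also have "\<dots> \<longleftrightarrow> [a = b] (mod n)"
      using that by (metis cong_altdef_nat cong_sym_eq)
    finally show ?thesis .
  qed
  show ?thesis
    using *[of a b] *[of b a] by (metis cong_sym_eq le_cases)
qed

lemma coprime_n_iff: "coprime a n \<longleftrightarrow> coprime a p"
  using i_pos by (simp add: coprime_power_right_iff)

lemma Z_power_mem:
  assumes "z \<in> Z" "coprime a p"
  shows "z ^ a \<in> Z"
proof -
  have "(z ^ a) ^ n = 1" using Z_root[OF assms(1)] by (metis mult.commute power_mult power_one)
  moreover have "(z ^ a) ^ m \<noteq> 1"
  proof
    assume "(z ^ a) ^ m = 1"
    then have "n dvd a * m" using Z_power_eq_1_iff[OF assms(1)] by (metis power_mult)
    then have "p dvd a" using m_pos prime_gt_0_nat[OF prime_p] unfolding n_eq by (simp add: mult.commute)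
    then show False using assms(2) prime_p
      by (metis coprime_absorb_right coprime_commute not_prime_unit prime_nat_iff is_unit_gcd gcd_nat.absorb2 not_prime_1)
  qed
  ultimately show ?thesis by (simp add: prim_roots_def)
qed

lemma Z_subset: "Z = {z. z ^ n = 1} - {z. z ^ m = 1}"
  by (auto simp: prim_roots_def)

lemma m_roots_subset: "{z :: complex. z ^ m = 1} \<subseteq> {z. z ^ n = 1}"
  by (auto simp: n_eq power_mult)

lemma finite_Z: "finite Z"
  unfolding Z_subset using finite_roots_unity[of n] n_pos by auto

lemma card_Z: "card Z = m * (p - 1)"
proof -
  have "card Z = card {z :: complex. z ^ n = 1} - card {z :: complex. z ^ m = 1}"
    unfolding Z_subset using m_roots_subset m_pos finite_roots_unity[of m]
    by (intro card_Diff_subset) auto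
  also have "\<dots> = n - m"
    using card_roots_unity_eq n_pos m_pos by simp
  finally show ?thesis by (simp add: n_eq algebra_simps)
qed

lemma Z_nonempty: "Z \<noteq> {}"
  using card_Z m_pos p_ge_3 by (auto simp del: card_0_eq)

lemma card_Z_eq_totient: "card Z = totient n"
  using card_Z prime_p i_pos by (simp add: totient_prime_power)

lemma even_card_Z: "even (card Z)"
  using card_Z odd_p by simp

lemma bij_totatives:
  assumes "z \<in> Z"
  shows "bij_betw (\<lambda>a. z ^ a) (totatives n) Z"
proof -
  have inj: "inj_on (\<lambda>a. z ^ a) (totatives n)"
  proof (rule inj_onI)
    fix a b assume ab: "a \<in> totatives n" "b \<in> totatives n" "z ^ a = z ^ b"
    then have "[a = b] (mod n)" using Z_power_eq_iff[OF assms] by simp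
    then show "a = b"
      using ab(1,2) by (metis cong_less_modulus_unique_nat totatives_less totatives_le
        le_eq_less_or_eq cong_def mod_less mod_self in_totatives_iff less_irrefl)
  qed
  moreover have "(\<lambda>a. z ^ a) ` totatives n \<subseteq> Z"
    using Z_power_mem[OF assms] coprime_n_iff by (auto simp: in_totatives_iff)
  moreover have "card (totatives n) = card Z"
    using card_Z_eq_totient by (simp add: totient_def)
  ultimately show ?thesis
    using finite_Z by (simp add: bij_betw_def card_image card_subset_eq)
qed

lemma cyclotomic_mult: "ev (cyclotomic p i) z * (z ^ m - 1) = z ^ n - 1"
proof -
  have "ev (cyclotomic p i) z = (\<Sum>k<p. (z ^ m) ^ k)"
    by (simp add: cyclotomic_def power_mult)
  then show ?thesis
    using power_diff_1_eq[of "z ^ m" p]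
    by (simp add: n_eq mult.commute del: One_nat_def flip: power_mult)
qed

lemma cyclotomic_Z: "z \<in> Z \<Longrightarrow> ev (cyclotomic p i) z = 0"
  using cyclotomic_mult[of z] by (simp add: prim_roots_def)

lemma cyclotomic_m_root: "z ^ m = 1 \<Longrightarrow> ev (cyclotomic p i) z = of_nat p"
  by (simp add: cyclotomic_def power_mult)

lemma cyclotomic_1: "poly (cyclotomic p i) 1 = int p"
  by (simp add: cyclotomic_def poly_sum poly_monom)

lemma coeff_cyclotomic: "coeff (cyclotomic p i) j = (\<Sum>k<p. if m * k = j then 1 else 0)"
  by (simp add: cyclotomic_def coeff_sum)

lemma coeff_cyclotomic_top: "coeff (cyclotomic p i) (m * (p - 1)) = 1"
proof -
  have "(\<Sum>k<p. if m * k = m * (p - 1) then 1 else (0::int)) = (\<Sum>k<p. if k = p - 1 then 1 else 0)"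
    using m_pos prime_gt_0_nat[OF prime_p] by (intro sum.cong) auto
  then show ?thesis using p_ge_3 by (simp add: coeff_cyclotomic)
qed

lemma degree_cyclotomic: "degree (cyclotomic p i) = m * (p - 1)"
proof (rule antisym)
  show "degree (cyclotomic p i) \<le> m * (p - 1)"
    unfolding cyclotomic_def
    by (intro degree_sum_le) (auto intro: order_trans[OF degree_monom_le])
  show "m * (p - 1) \<le> degree (cyclotomic p i)"
    by (rule le_degree) (simp add: coeff_cyclotomic_top del: One_nat_def)
qed

lemma monic_cyclotomic: "lead_coeff (cyclotomic p i) = 1"
  by (simp add: degree_cyclotomic coeff_cyclotomic_top del: One_nat_def)

lemma cyclotomic_dvd: "(\<And>z. z \<in> Z \<Longrightarrow> ev P z = 0) \<Longrightarrow> cyclotomic p i dvd P"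
  using monic_dvd_if_vanishes[OF monic_cyclotomic finite_Z] card_Z degree_cyclotomic cyclotomic_Z
  by simp

lemma cyclotomic_eq_prod: "ev (cyclotomic p i) x = (\<Prod>z\<in>Z. x - z)"
proof -
  define A :: "complex poly" where "A = map_poly of_int (cyclotomic p i)"
  define B where "B = (\<Prod>z\<in>Z. [:- z, 1:])"
  have dB: "degree B = card Z"
    unfolding B_def by (subst degree_prod_sum_eq) auto
  have lB: "coeff B (card Z) = 1"
    using lead_coeff_prod[of "\<lambda>z. [:- z, 1:]" Z] dB unfolding B_def by simp
  have dA: "degree A = card Z" by (simp add: A_def degree_map_poly degree_cyclotomic card_Z)
  have lA: "coeff A (card Z) = 1"
    by (simp add: A_def coeff_map_poly coeff_cyclotomic_top card_Z del: One_nat_def)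
  have "A - B = 0"
  proof (rule ccontr)
    assume ne: "A - B \<noteq> 0"
    have "degree (A - B) \<le> card Z" using dA dB by (intro degree_diff_le) auto
    moreover have "coeff (A - B) (card Z) = 0" using lA lB by simp
    ultimately have lt: "degree (A - B) < card Z"
      using ne by (metis le_neq_implies_less leading_coeff_0_iff)
    have "Z \<subseteq> {z. poly (A - B) z = 0}"
      using cyclotomic_Z finite_Z by (auto simp: A_def B_def ev_def poly_prod)
    then have "card Z \<le> card {z. poly (A - B) z = 0}"
      by (rule card_mono[OF poly_roots_finite[OF ne]])
    also have "\<dots> \<le> degree (A - B)" by (rule card_poly_roots_bound[OF ne])
    finally show False using lt by simp
  qed
  then have "poly A x = poly B x" by simp
  then show ?thesis by (simp add: A_def B_def ev_def poly_prod)
qed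

text \<open>The number of primitive roots is even, so the norms of z - 1 and 1 - z agree. Thus z - 1
  is a uniformizer at p, of norm exactly p.\<close>

lemma prod_Z_minus_1: "(\<Prod>z\<in>Z. z - 1) = of_nat p"
proof -
  have "(\<Prod>z\<in>Z. z - 1) = (\<Prod>z\<in>Z. (- 1) * (1 - z))" by (intro prod.cong) auto
  also have "\<dots> = (\<Prod>z\<in>Z. 1 - z)"
    using even_card_Z by (simp only: prod.distrib prod_constant) simp
  also have "\<dots> = of_nat p"
    using cyclotomic_eq_prod[of 1] by (simp add: ev_one_arg cyclotomic_1)
  finally show ?thesis .
qed

section \<open>Cyclotomic integers as functions on the primitive roots\<close>

text \<open>This is Z[zeta], each element being recorded by its values under all embeddings at once.
  Values of \<open>f\<close> outside \<open>Z\<close> do not matter.\<close>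

definition cycint :: "(complex \<Rightarrow> complex) \<Rightarrow> bool" where
  "cycint f \<longleftrightarrow> (\<exists>F. \<forall>z\<in>Z. f z = ev F z)"

named_theorems cycint_intros

lemma cycintI: "(\<And>z. z \<in> Z \<Longrightarrow> f z = ev F z) \<Longrightarrow> cycint f"
  by (auto simp: cycint_def)

lemma cycint_ev [cycint_intros]: "cycint (\<lambda>z. ev F z)"
  by (auto simp: cycint_def)

lemma cycint_of_int [cycint_intros]: "cycint (\<lambda>z. of_int a)"
  by (rule cycintI[of _ "[:a:]"]) simp

lemma cycint_of_nat [cycint_intros]: "cycint (\<lambda>z. of_nat a)"
  using cycint_of_int[of "int a"] by simp

lemma cycint_1 [cycint_intros]: "cycint (\<lambda>z. 1)"
  using cycint_of_int[of 1] by simp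

lemma cycint_0 [cycint_intros]: "cycint (\<lambda>z. 0)"
  using cycint_of_int[of 0] by simp

lemma cycint_id [cycint_intros]: "cycint (\<lambda>z. z)"
  by (rule cycintI[of _ "[:0, 1:]"]) simp

lemma cycint_add [cycint_intros]: "cycint f \<Longrightarrow> cycint g \<Longrightarrow> cycint (\<lambda>z. f z + g z)"
  unfolding cycint_def by (metis ev_add)

lemma cycint_diff [cycint_intros]: "cycint f \<Longrightarrow> cycint g \<Longrightarrow> cycint (\<lambda>z. f z - g z)"
  unfolding cycint_def by (metis ev_diff)

lemma cycint_mult [cycint_intros]: "cycint f \<Longrightarrow> cycint g \<Longrightarrow> cycint (\<lambda>z. f z * g z)"
  unfolding cycint_def by (metis ev_mult)

lemma cycint_power [cycint_intros]: "cycint f \<Longrightarrow> cycint (\<lambda>z. f z ^ k)"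
  by (induction k) (auto intro: cycint_intros)

lemma cycint_sum [cycint_intros]:
  "(\<And>x. x \<in> A \<Longrightarrow> cycint (f x)) \<Longrightarrow> cycint (\<lambda>z. \<Sum>x\<in>A. f x z)"
  by (induction A rule: infinite_finite_induct) (auto intro: cycint_intros)

lemma cycint_prod [cycint_intros]:
  "(\<And>x. x \<in> A \<Longrightarrow> cycint (f x)) \<Longrightarrow> cycint (\<lambda>z. \<Prod>x\<in>A. f x z)"
  by (induction A rule: infinite_finite_induct) (auto intro: cycint_intros)

lemma cycint_galois:
  assumes "cycint f" "coprime a p"
  shows "cycint (\<lambda>z. f (z ^ a))"
proof -
  obtain F where F: "\<forall>z\<in>Z. f z = ev F z" using assms(1) by (auto simp: cycint_def)
  show ?thesis
    by (rule cycintI[of _ "pcompose F (Polynomial.monom 1 a)"]) (use F Z_power_mem assms(2) in auto)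
qed

lemma cycint_galois_pow [cycint_intros]:
  "cycint f \<Longrightarrow> coprime a p \<Longrightarrow> cycint (\<lambda>z. f (z ^ (a ^ k)))"
  by (rule cycint_galois) auto

lemma cycint_cnj [cycint_intros]:
  assumes "cycint f"
  shows "cycint (\<lambda>z. cnj (f z))"
proof -
  obtain F where F: "\<forall>z\<in>Z. f z = ev F z" using assms by (auto simp: cycint_def)
  show ?thesis
  proof (rule cycintI[of _ "pcompose F (Polynomial.monom 1 (n - 1))"])
    fix z assume z: "z \<in> Z"
    then have "cnj z = z ^ (n - 1)" using cnj_root_of_unity[OF Z_root n_pos] by simp
    then show "cnj (f z) = ev (pcompose F (Polynomial.monom 1 (n - 1))) z"
      using F z ev_cnj[of F z] by simp
  qed
qed

lemma cycint_cnj_arg: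
  assumes "cycint f" "z \<in> Z"
  shows "f (z ^ (n - 1)) = cnj (f z)"
proof -
  obtain F where F: "\<forall>z\<in>Z. f z = ev F z" using assms by (auto simp: cycint_def)
  have "p dvd n" using i_pos by simp
  have "coprime (n - 1) p"
  proof (rule coprimeI)
    fix c assume "c dvd n - 1" "c dvd p"
    then have "c dvd n - (n - 1)" using \<open>p dvd n\<close> by (meson dvd_diff_nat dvd_trans)
    then show "is_unit c" using n_pos by simp
  qed
  then have "z ^ (n - 1) \<in> Z" using Z_power_mem assms(2) by blast
  then show ?thesis
    using F assms(2) ev_cnj[of F z] cnj_root_of_unity[OF Z_root n_pos] by simp
qed

text \<open>An element equal to all its conjugates: reduction modulo the monic cyclotomic polynomial
  leaves a remainder constant on \<open>Z\<close>, hence an integer. It plays the role of "a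
  rational algebraic integer is an integer".\<close>

lemma cycint_const:
  assumes "cycint f" "\<And>z. z \<in> Z \<Longrightarrow> f z = c"
  shows "c \<in> \<int>"
proof -
  obtain F where F: "\<forall>z\<in>Z. f z = ev F z" using assms(1) by (auto simp: cycint_def)
  obtain Q R where QR: "F = cyclotomic p i * Q + R" "R = 0 \<or> degree R < degree (cyclotomic p i)"
    using monic_division[OF monic_cyclotomic] by metis
  have "ev R z = c" if "z \<in> Z" for z
    using F assms(2) that cyclotomic_Z[OF that] QR(1) by simp
  then have "c = of_int (coeff R 0)"
    using ev_eq_const_imp[OF finite_Z, of R c] QR(2) Z_nonempty
    by (simp add: card_Z degree_cyclotomic)
  then show ?thesis by simp
qed

lemma prod_Z_galois:
  assumes "z \<in> Z"
  shows "(\<Prod>a\<in>totatives n. f (z ^ a)) = (\<Prod>w\<in>Z. f w)"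
  using prod.reindex_bij_betw[OF bij_totatives[OF assms]] .

lemma coprime_totatives: "a \<in> totatives n \<Longrightarrow> coprime a p"
  using coprime_n_iff by (simp add: in_totatives_iff)

lemma cycint_norm:
  assumes "cycint f"
  shows "(\<Prod>z\<in>Z. f z) \<in> \<int>"
proof (rule cycint_const)
  show "cycint (\<lambda>z. \<Prod>a\<in>totatives n. f (z ^ a))"
    using assms coprime_totatives by (intro cycint_prod cycint_galois)
  show "(\<Prod>a\<in>totatives n. f (z ^ a)) = (\<Prod>z\<in>Z. f z)" if "z \<in> Z" for z
    by (rule prod_Z_galois[OF that])
qed

text \<open>The cofactor is the product of the remaining conjugates, all automorphisms except a =
  1.\<close>

lemma cycint_norm_multiple:
  assumes "cycint f"
  obtains g where "cycint g" "\<And>z. z \<in> Z \<Longrightarrow> f z * g z = (\<Prod>w\<in>Z. f w)"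
proof
  show "cycint (\<lambda>z. \<Prod>a\<in>totatives n - {1}. f (z ^ a))"
    using assms coprime_totatives by (intro cycint_prod cycint_galois) auto
  fix z assume z: "z \<in> Z"
  have "1 \<in> totatives n" using n_pos by (simp add: in_totatives_iff Suc_le_eq del: zero_less_power_eq)
  then show "f z * (\<Prod>a\<in>totatives n - {1}. f (z ^ a)) = (\<Prod>w\<in>Z. f w)"
    using prod.remove[of "totatives n" 1 "\<lambda>a. f (z ^ a)"] prod_Z_galois[OF z, of f] by simp
qed

section \<open>Congruences modulo a rational integer and the Frobenius map\<close>

text \<open>Congruence modulo the ideal generated by \<open>q\<close>. Only the quotient
  \<open>h\<close> is required to be a cyclotomic integer, so reflexivity, symmetry and transitivity
  hold without side conditions on \<open>f\<close> and \<open>g\<close>.\<close>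

definition cyccong :: "int \<Rightarrow> (complex \<Rightarrow> complex) \<Rightarrow> (complex \<Rightarrow> complex) \<Rightarrow> bool" where
  "cyccong q f g = (\<exists>h. cycint h \<and> (\<forall>z\<in>Z. f z = g z + of_int q * h z))"

lemma cyccongI:
  "cycint h \<Longrightarrow> (\<And>z. z \<in> Z \<Longrightarrow> f z = g z + of_int q * h z) \<Longrightarrow> cyccong q f g"
  by (auto simp: cyccong_def)

lemma cyccong_refl [simp]: "cyccong q f f"
  by (rule cyccongI[OF cycint_0]) simp

lemma cyccong_eq: "(\<And>z. z \<in> Z \<Longrightarrow> f z = g z) \<Longrightarrow> cyccong q f g"
  by (rule cyccongI[OF cycint_0]) simp

lemma cyccong_sym: "cyccong q f g \<Longrightarrow> cyccong q g f"
proof -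
  assume "cyccong q f g"
  then obtain h where h: "cycint h" "\<forall>z\<in>Z. f z = g z + of_int q * h z" by (auto simp: cyccong_def)
  show ?thesis
    by (rule cyccongI[OF cycint_diff[OF cycint_0 h(1)]]) (use h(2) in simp)
qed

lemma cyccong_trans [trans]: "cyccong q f g \<Longrightarrow> cyccong q g h \<Longrightarrow> cyccong q f h"
proof -
  assume "cyccong q f g" "cyccong q g h"
  then obtain a b where ab: "cycint a" "\<forall>z\<in>Z. f z = g z + of_int q * a z"
    "cycint b" "\<forall>z\<in>Z. g z = h z + of_int q * b z" unfolding cyccong_def by blast
  show ?thesis
    by (rule cyccongI[of "\<lambda>z. a z + b z"]) (use ab in \<open>auto intro: cycint_intros simp: algebra_simps\<close>)
qed

lemma cyccong_add:
  assumes "cyccong q f f'" "cyccong q g g'"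
  shows "cyccong q (\<lambda>z. f z + g z) (\<lambda>z. f' z + g' z)"
proof -
  obtain a b where ab: "cycint a" "\<forall>z\<in>Z. f z = f' z + of_int q * a z"
    "cycint b" "\<forall>z\<in>Z. g z = g' z + of_int q * b z" using assms by (auto simp: cyccong_def)
  show ?thesis
    by (rule cyccongI[of "\<lambda>z. a z + b z"]) (use ab in \<open>auto intro: cycint_intros simp: algebra_simps\<close>)
qed

lemma cyccong_mult:
  assumes "cyccong q f f'" "cyccong q g g'" "cycint f'" "cycint g'"
  shows "cyccong q (\<lambda>z. f z * g z) (\<lambda>z. f' z * g' z)"
proof -
  obtain a b where ab: "cycint a" "\<forall>z\<in>Z. f z = f' z + of_int q * a z"
    "cycint b" "\<forall>z\<in>Z. g z = g' z + of_int q * b z" using assms by (auto simp: cyccong_def)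
  show ?thesis
    by (rule cyccongI[of "\<lambda>z. f' z * b z + a z * g' z + of_int q * (a z * b z)"])
       (use ab assms(3,4) in \<open>auto intro!: cycint_intros simp: algebra_simps\<close>)
qed

lemma cyccong_prod:
  assumes "\<And>x. x \<in> A \<Longrightarrow> cyccong q (f x) (g x)" "\<And>x. x \<in> A \<Longrightarrow> cycint (g x)"
  shows "cyccong q (\<lambda>z. \<Prod>x\<in>A. f x z) (\<lambda>z. \<Prod>x\<in>A. g x z)"
  using assms
proof (induction A rule: infinite_finite_induct)
  case (insert x A)
  then have "cyccong q (\<lambda>z. f x z * (\<Prod>x\<in>A. f x z)) (\<lambda>z. g x z * (\<Prod>x\<in>A. g x z))"
    by (intro cyccong_mult cycint_intros) auto
  then show ?case using insert(1,2) by simp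
qed simp_all

lemma cyccong_power:
  assumes "cyccong q f g" "cycint g"
  shows "cyccong q (\<lambda>z. f z ^ k) (\<lambda>z. g z ^ k)"
  using cyccong_prod[of "{..<k}" q "\<lambda>_. f" "\<lambda>_. g"] assms by simp

lemma cyccong_galois:
  assumes "cyccong q f g" "coprime a p"
  shows "cyccong q (\<lambda>z. f (z ^ a)) (\<lambda>z. g (z ^ a))"
proof -
  obtain h where h: "cycint h" "\<forall>z\<in>Z. f z = g z + of_int q * h z"
    using assms by (auto simp: cyccong_def)
  show ?thesis
    by (rule cyccongI[OF cycint_galois[OF h(1) assms(2)]]) (use h Z_power_mem assms(2) in auto)
qed

text \<open>The way back to divisibility in Z: the quotient a/q is a constant cyclotomic
  integer.\<close>

lemma cyccong_const_dvd:
  assumes "cyccong q (\<lambda>z. of_int a) (\<lambda>z. 0)"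
  shows "q dvd a"
proof (cases "q = 0")
  case True
  then show ?thesis using assms Z_nonempty by (auto simp: cyccong_def)
next
  case False
  obtain h where h: "cycint h" "\<forall>z\<in>Z. of_int a = of_int q * h z"
    using assms by (auto simp: cyccong_def)
  have "h z = of_int a / of_int q" if "z \<in> Z" for z
    using h(2) that False by (auto simp: field_simps)
  then have "of_int a / of_int q \<in> (\<int> :: complex set)" using cycint_const[OF h(1)] by blast
  then obtain b where "of_int a / of_int q = (of_int b :: complex)" by (auto elim: Ints_cases)
  then have "of_int a = (of_int (b * q) :: complex)" using False by (simp add: field_simps)
  then show ?thesis by (metis dvd_triv_right of_int_eq_iff)
qed

lemma cyccong_add_prime_power:
  assumes "prime q" "cycint f" "cycint g"
  shows "cyccong (int q) (\<lambda>z. (f z + g z) ^ q) (\<lambda>z. f z ^ q + g z ^ q)"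
  by (rule cyccongI[where h = "\<lambda>z. \<Sum>k\<in>{1..<q}. of_nat ((q choose k) div q) * f z ^ k * g z ^ (q - k)"])
     (use assms in \<open>auto intro!: cycint_intros simp: binomial_prime_expansion\<close>)

text \<open>Induction over the coefficients of a representing polynomial: Fermat handles each
  coefficient, and q-th powers are additive modulo q. The condition q \<noteq> p keeps z^q among the
  primitive roots.\<close>

lemma frobenius:
  assumes "prime q" "q \<noteq> p" "cycint f"
  shows "cyccong (int q) (\<lambda>z. f (z ^ q)) (\<lambda>z. f z ^ q)"
proof -
  have cop: "coprime q p" using assms prime_p by (simp add: primes_coprime)
  have *: "cyccong (int q) (\<lambda>z. ev F (z ^ q)) (\<lambda>z. ev F z ^ q)" for F
  proof (induction F)
    case 0
    show ?case using assms(1) prime_gt_0_nat[of q] by (auto simp: power_0_left)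
  next
    case (pCons a F)
    obtain b where b: "a ^ q - a = int q * b" using int_fermat[OF assms(1)] by blast
    have "cyccong (int q) (\<lambda>z. of_int a) (\<lambda>z. of_int a ^ q)"
    proof (rule cyccongI)
      show "cycint (\<lambda>z. of_int (- b))" by (rule cycint_of_int)
      show "(of_int a :: complex) = of_int a ^ q + of_int (int q) * of_int (- b)"
        using arg_cong[OF b, of "of_int :: int \<Rightarrow> complex"] by (simp add: algebra_simps)
    qed
    moreover have "cyccong (int q) (\<lambda>z. z ^ q * ev F (z ^ q)) (\<lambda>z. z ^ q * ev F z ^ q)"
      using pCons(2) by (intro cyccong_mult cycint_intros) auto
    ultimately have "cyccong (int q) (\<lambda>z. of_int a + z ^ q * ev F (z ^ q))
       (\<lambda>z. of_int a ^ q + z ^ q * ev F z ^ q)"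
      by (rule cyccong_add)
    also have "cyccong (int q) (\<lambda>z. of_int a ^ q + z ^ q * ev F z ^ q) (\<lambda>z. (of_int a + z * ev F z) ^ q)"
      using cyccong_sym[OF cyccong_add_prime_power[OF assms(1), of "\<lambda>z. of_int a" "\<lambda>z. z * ev F z"]]
        cycint_of_int cycint_mult[OF cycint_id cycint_ev]
      by (simp add: power_mult_distrib)
    finally show ?case by simp
  qed
  obtain F where F: "\<forall>z\<in>Z. f z = ev F z" using assms(3) by (auto simp: cycint_def)
  have "cyccong (int q) (\<lambda>z. f (z ^ q)) (\<lambda>z. ev F (z ^ q))"
    using F Z_power_mem cop by (intro cyccong_eq) auto
  also note *[of F]
  also have "cyccong (int q) (\<lambda>z. ev F z ^ q) (\<lambda>z. f z ^ q)"
    using F by (intro cyccong_eq) auto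
  finally show ?thesis .
qed

lemma frobenius_power:
  assumes "prime q" "q \<noteq> p" "cycint f"
  shows "cyccong (int q) (\<lambda>z. f (z ^ (q ^ k))) (\<lambda>z. f z ^ (q ^ k))"
proof (induction k)
  case (Suc k)
  have cop: "coprime q p" using assms prime_p by (simp add: primes_coprime)
  have "cyccong (int q) (\<lambda>z. f ((z ^ q) ^ (q ^ k))) (\<lambda>z. f (z ^ q) ^ (q ^ k))"
    using cyccong_galois[OF Suc cop] .
  also have "cyccong (int q) (\<lambda>z. f (z ^ q) ^ (q ^ k)) (\<lambda>z. (f z ^ q) ^ (q ^ k))"
    using assms by (intro cyccong_power frobenius cycint_intros)
  finally show ?case by (simp add: power_mult mult.commute)
qed simp

section \<open>Divisibility of conjugates: Frobenius and complex conjugation\<close>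

lemma coprime_prime: "prime q \<Longrightarrow> q \<noteq> p \<Longrightarrow> coprime q p"
  using prime_p by (simp add: primes_coprime)

text \<open>Modulo $q$ the function $\alpha$ is an associate of the idempotent $\alpha^{q^f-1}$, which has the
  Frobenius-invariant lift $e$. Hence $q$ divides $\alpha(1-e)$, and the quotient is treated by induction.\<close>

lemma dvd_frobenius_conjugate:
  assumes "prime q" "q \<noteq> p" "cycint \<alpha>"
  shows "\<exists>\<beta>. cycint \<beta> \<and> cyccong (int q ^ K) (\<lambda>z. \<alpha> (z ^ q)) (\<lambda>z. \<alpha> z * \<beta> z)"
  using assms(3)
proof (induction K arbitrary: \<alpha>)
  case 0
  have "cyccong (int q ^ 0) (\<lambda>z. \<alpha> (z ^ q)) (\<lambda>z. \<alpha> z * 0)"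
    by (rule cyccongI[of "\<lambda>z. \<alpha> (z ^ q)"])
       (use 0 assms in \<open>auto intro: cycint_galois coprime_prime\<close>)
  then show ?case using cycint_0 by blast
next
  case (Suc K)
  note [cycint_intros] = Suc.prems
  have cop: "coprime q p" using assms coprime_prime by blast
  have q2: "q \<ge> 2" using assms(1) prime_ge_2_nat by blast
  \<comment> \<open>By Euler, q^\<open>Suc f\<close> is 1 modulo \<open>n\<close>, so Frobenius
    permutes the factors of the product over k < \<open>Suc f\<close> cyclically. The successor form
    makes that shift immediate.\<close>
  define f where "f = totient n - 1"
  have Sf: "totient n = Suc f"
    using n_pos by (simp add: f_def)
  have qf: "[q ^ Suc f = 1] (mod n)"
    using euler_theorem[of q n] cop coprime_n_iff Sf by simp
  define g where "g k z = \<alpha> (z ^ (q ^ k)) ^ (q - 1)" for k z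
  define e where "e z = (\<Prod>k<Suc f. g k z)" for z
  \<comment> \<open>\<open>e\<close> with one factor \<alpha> removed from the term k = 0; for q = 2
    the remaining exponent q - 2 is 0.\<close>
  define e' where "e' z = \<alpha> z ^ (q - 2) * (\<Prod>k<f. g (Suc k) z)" for z
  have cg [cycint_intros]: "cycint (g k)" for k
    unfolding g_def using cop by (intro cycint_intros)
  have ce [cycint_intros]: "cycint e" and ce' [cycint_intros]: "cycint e'"
    unfolding e_def e'_def by (intro cycint_intros)+
  have e_eq: "e z = \<alpha> z * e' z" for z
  proof -
    have "e z = g 0 z * (\<Prod>k<f. g (Suc k) z)"
      unfolding e_def by (rule prod.lessThan_Suc_shift)
    moreover have "q - 1 = Suc (q - 2)" using q2 by simp
    then have "g 0 z = \<alpha> z * \<alpha> z ^ (q - 2)"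
      unfolding g_def by (simp only: power_0 power_one_right power_Suc)
    ultimately show ?thesis by (simp add: e'_def)
  qed
  have inv: "e (z ^ q) = e z" if "z \<in> Z" for z
  proof -
    have "e (z ^ q) = (\<Prod>k<Suc f. g (Suc k) z)"
      by (simp add: e_def g_def flip: power_mult)
    also have "\<dots> = (\<Prod>k<f. g (Suc k) z) * g (Suc f) z" by simp
    also have "g (Suc f) z = g 0 z"
      using qf Z_power_eq_iff[OF that, of "q ^ Suc f" 1] by (simp add: g_def)
    also have "(\<Prod>k<f. g (Suc k) z) * g 0 z = e z"
      unfolding e_def prod.lessThan_Suc_shift by simp
    finally show ?thesis .
  qed
  have "cyccong (int q) e (\<lambda>z. \<Prod>k<Suc f. (\<alpha> z ^ (q ^ k)) ^ (q - 1))"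
    unfolding e_def g_def using assms cop
    by (intro cyccong_prod cyccong_power frobenius_power cycint_intros)
  then have "cyccong (int q) (\<lambda>z. \<alpha> z * e z) (\<lambda>z. \<alpha> z * (\<Prod>k<Suc f. (\<alpha> z ^ (q ^ k)) ^ (q - 1)))"
    by (intro cyccong_mult cyccong_refl cycint_intros)
  also have "(\<lambda>z. \<alpha> z * (\<Prod>k<Suc f. (\<alpha> z ^ (q ^ k)) ^ (q - 1))) = (\<lambda>z. \<alpha> z ^ (q ^ Suc f))"
    using prod_power_power_mult[of q _ "Suc f"] q2 by (intro ext) simp
  also have "cyccong (int q) \<dots> (\<lambda>z. \<alpha> (z ^ (q ^ Suc f)))"
    using assms by (intro cyccong_sym[OF frobenius_power] Suc.prems)
  also have "cyccong (int q) (\<lambda>z. \<alpha> (z ^ (q ^ Suc f))) \<alpha>"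
    using qf Z_power_eq_iff[of _ "q ^ Suc f" 1] by (intro cyccong_eq) simp
  finally have "cyccong (int q) \<alpha> (\<lambda>z. \<alpha> z * e z)" by (rule cyccong_sym)
  then obtain \<alpha>' where \<alpha>': "cycint \<alpha>'" "\<And>z. z \<in> Z \<Longrightarrow> \<alpha> z = \<alpha> z * e z + of_int (int q) * \<alpha>' z"
    by (auto simp: cyccong_def)
  obtain \<beta>' where \<beta>': "cycint \<beta>'" "cyccong (int q ^ K) (\<lambda>z. \<alpha>' (z ^ q)) (\<lambda>z. \<alpha>' z * \<beta>' z)"
    using Suc.IH[OF \<alpha>'(1)] by blast
  obtain \<gamma> where \<gamma>: "cycint \<gamma>"
    "\<And>z. z \<in> Z \<Longrightarrow> \<alpha>' (z ^ q) = \<alpha>' z * \<beta>' z + of_int (int q ^ K) * \<gamma> z"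
    using \<beta>'(2) by (auto simp: cyccong_def)
  \<comment> \<open>Applying Frobenius to \<alpha> = \<alpha> e + q \<alpha>' gives two terms. The
    first is a multiple of \<alpha> since e = \<alpha> e'; the second is one up to q^(K+1), since q
    \<alpha>' = \<alpha> (1 - e) and the induction hypothesis treats \<alpha>'.\<close>
  define \<beta> where "\<beta> z = \<alpha> (z ^ q) * e' z + (1 - e z) * \<beta>' z" for z
  have "cycint \<beta>" unfolding \<beta>_def
    using cycint_galois[OF Suc.prems cop] by (intro cycint_intros \<beta>'(1))
  moreover have "cyccong (int q ^ Suc K) (\<lambda>z. \<alpha> (z ^ q)) (\<lambda>z. \<alpha> z * \<beta> z)"
  proof (rule cyccongI[OF \<gamma>(1)])
    fix z assume z: "z \<in> Z"
    have "\<alpha> (z ^ q) = \<alpha> (z ^ q) * e z + of_int (int q) * \<alpha>' (z ^ q)"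
      using \<alpha>'(2)[of "z ^ q"] Z_power_mem[OF z cop] inv[OF z] by simp
    also have "\<dots> = \<alpha> (z ^ q) * e z + (of_int (int q) * \<alpha>' z) * \<beta>' z + of_int (int q ^ Suc K) * \<gamma> z"
      using \<gamma>(2)[OF z] by (simp add: algebra_simps)
    also have "of_int (int q) * \<alpha>' z = \<alpha> z - \<alpha> z * e z"
      using \<alpha>'(2)[OF z] by (simp add: algebra_simps)
    finally show "\<alpha> (z ^ q) = \<alpha> z * \<beta> z + of_int (int q ^ Suc K) * \<gamma> z"
      by (simp add: \<beta>_def e_eq algebra_simps)
  qed
  ultimately show ?case by blast
qed

lemma dvd_frobenius_power_conjugate:
  assumes "prime q" "q \<noteq> p" "cycint \<alpha>"
  shows "\<exists>\<beta>. cycint \<beta> \<and> cyccong (int q ^ K) (\<lambda>z. \<alpha> (z ^ (q ^ k))) (\<lambda>z. \<alpha> z * \<beta> z)"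
proof (induction k)
  case 0
  show ?case by (rule exI[of _ "\<lambda>z. 1"]) (auto intro: cycint_intros)
next
  case (Suc k)
  have cop: "coprime q p" using assms coprime_prime by blast
  obtain \<beta> where \<beta>: "cycint \<beta>" "cyccong (int q ^ K) (\<lambda>z. \<alpha> (z ^ (q ^ k))) (\<lambda>z. \<alpha> z * \<beta> z)"
    using Suc by blast
  obtain \<gamma> where \<gamma>: "cycint \<gamma>" "cyccong (int q ^ K) (\<lambda>z. \<alpha> (z ^ q)) (\<lambda>z. \<alpha> z * \<gamma> z)"
    using dvd_frobenius_conjugate[OF assms] by blast
  note [cycint_intros] = \<beta>(1) \<gamma>(1) assms(3)
  have [cycint_intros]: "cycint (\<lambda>z. \<beta> (z ^ q))" by (rule cycint_galois[OF \<beta>(1) cop])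
  have "cyccong (int q ^ K) (\<lambda>z. \<alpha> ((z ^ q) ^ (q ^ k))) (\<lambda>z. \<alpha> (z ^ q) * \<beta> (z ^ q))"
    using cyccong_galois[OF \<beta>(2) cop] .
  also have "cyccong (int q ^ K) \<dots> (\<lambda>z. (\<alpha> z * \<gamma> z) * \<beta> (z ^ q))"
    by (intro cyccong_mult \<gamma>(2) cyccong_refl cycint_intros)
  finally have "cyccong (int q ^ K) (\<lambda>z. \<alpha> (z ^ (q ^ Suc k))) (\<lambda>z. \<alpha> z * (\<gamma> z * \<beta> (z ^ q)))"
    by (simp add: mult.assoc flip: power_mult)
  moreover have "cycint (\<lambda>z. \<gamma> z * \<beta> (z ^ q))" by (intro cycint_intros)
  ultimately show ?case by blast
qed

text \<open>If q^h is -1 modulo \<open>n\<close>, the h-th Frobenius power is complex conjugation,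
  so \<alpha> divides its conjugate modulo every power of q. Splitting off one prime of
  \<open>d\<close> at a time, the Chinese remainder theorem glues the quotients.\<close>

lemma dvd_cnj_mod:
  assumes "cycint \<alpha>" "d > 0"
    and "\<And>q. prime q \<Longrightarrow> q dvd d \<Longrightarrow> q \<noteq> p \<and> (\<exists>h. n dvd q ^ h + 1)"
  shows "\<exists>\<beta>. cycint \<beta> \<and> cyccong (int d) (\<lambda>z. cnj (\<alpha> z)) (\<lambda>z. \<alpha> z * \<beta> z)"
  using assms(2,3)
proof (induction d rule: less_induct)
  case (less d)
  note [cycint_intros] = assms(1)
  show ?case
  proof (cases "d = 1")
    case True
    have "cyccong (int d) (\<lambda>z. cnj (\<alpha> z)) (\<lambda>z. \<alpha> z * 0)"
      by (rule cyccongI[of "\<lambda>z. cnj (\<alpha> z)"]) (use True in \<open>auto intro: cycint_intros\<close>)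
    then show ?thesis using cycint_0 by blast
  next
    case False
    then obtain q where q: "prime q" "q dvd d" by (metis prime_factor_nat)
    define K where "K = multiplicity q d"
    obtain d' where d': "d = q ^ K * d'" "\<not> q dvd d'"
      using multiplicity_decompose'[of d q] q(1) less.prems(1) K_def
      by (metis not_gr_zero not_prime_unit)
    have K: "K > 0" using d' q(2) by (cases K) auto
    have "d' > 0" using d' less.prems(1) by (cases d') auto
    moreover have "q ^ K > 1" using K prime_gt_1_nat[OF q(1)] by (intro one_less_power)
    ultimately have lt: "d' < d" using d' by simp
    obtain h where h: "q \<noteq> p" "n dvd q ^ h + 1" using less.prems(2)[OF q] by blast
    obtain \<beta>1 where \<beta>1: "cycint \<beta>1" "cyccong (int d') (\<lambda>z. cnj (\<alpha> z)) (\<lambda>z. \<alpha> z * \<beta>1 z)"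
      using less.IH[OF lt \<open>d' > 0\<close>] less.prems(2) d'(1) by (metis dvd_mult)
    obtain \<beta>2 where \<beta>2: "cycint \<beta>2"
      "cyccong (int q ^ K) (\<lambda>z. \<alpha> (z ^ (q ^ h))) (\<lambda>z. \<alpha> z * \<beta>2 z)"
      using dvd_frobenius_power_conjugate[OF q(1) h(1) assms(1)] by blast
    have "z ^ (q ^ h) = z ^ (n - 1)" if "z \<in> Z" for z
    proof -
      have "[q ^ h + 1 = (n - 1) + 1] (mod n)"
        using h(2) n_pos by (simp add: cong_def del: zero_less_power_eq)
      then have "[q ^ h = n - 1] (mod n)" using cong_add_rcancel_nat by blast
      then show ?thesis using Z_power_eq_iff[OF that] by blast
    qed
    then have "cyccong (int q ^ K) (\<lambda>z. cnj (\<alpha> z)) (\<lambda>z. \<alpha> (z ^ (q ^ h)))"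
      using cycint_cnj_arg[OF assms(1)] by (intro cyccong_eq) simp
    also note \<beta>2(2)
    finally have "cyccong (int q ^ K) (\<lambda>z. cnj (\<alpha> z)) (\<lambda>z. \<alpha> z * \<beta>2 z)" .
    then obtain \<gamma>2 where \<gamma>2: "cycint \<gamma>2"
      "\<And>z. z \<in> Z \<Longrightarrow> cnj (\<alpha> z) = \<alpha> z * \<beta>2 z + of_int (int q ^ K) * \<gamma>2 z"
      by (auto simp: cyccong_def)
    obtain \<gamma>1 where \<gamma>1: "cycint \<gamma>1"
      "\<And>z. z \<in> Z \<Longrightarrow> cnj (\<alpha> z) = \<alpha> z * \<beta>1 z + of_int (int d') * \<gamma>1 z"
      using \<beta>1(2) by (auto simp: cyccong_def)
    have "coprime (q ^ K) d'"
      using q(1) d'(2) by (simp add: prime_imp_coprime)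
    then have "coprime (int q ^ K) (int d')" by (metis coprime_int_iff of_nat_power)
    then obtain u v where uv: "u * int q ^ K + v * int d' = 1"
      using bezout_int[of "int q ^ K" "int d'"] by auto
    \<comment> \<open>\<open>\<beta>1\<close> is correct modulo \<open>d'\<close> and
      \<open>\<beta>2\<close> modulo q^K; these weights sum to 1 and turn both errors into multiples
      of \<open>d\<close>.\<close>
    define U V :: complex where "U = of_int (u * int q ^ K)" and "V = of_int (v * int d')"
    have UV: "U + V = 1" using arg_cong[OF uv, of "of_int :: int \<Rightarrow> complex"] by (simp add: U_def V_def)
    define \<beta> where "\<beta> z = U * \<beta>1 z + V * \<beta>2 z" for z
    define \<gamma> where "\<gamma> z = of_int u * \<gamma>1 z + of_int v * \<gamma>2 z" for z
    have "cycint \<beta>" "cycint \<gamma>"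
      unfolding \<beta>_def \<gamma>_def U_def V_def by (intro cycint_intros \<beta>1(1) \<beta>2(1) \<gamma>1(1) \<gamma>2(1))+
    moreover have "cnj (\<alpha> z) = \<alpha> z * \<beta> z + of_int (int d) * \<gamma> z" if "z \<in> Z" for z
    proof -
      have "cnj (\<alpha> z) = U * cnj (\<alpha> z) + V * cnj (\<alpha> z)"
        using UV by (simp flip: distrib_right)
      also have "\<dots> = U * (\<alpha> z * \<beta>1 z + of_int (int d') * \<gamma>1 z) + V * (\<alpha> z * \<beta>2 z + of_int (int q ^ K) * \<gamma>2 z)"
        by (subst \<gamma>1(2)[OF that], subst \<gamma>2(2)[OF that]) simp
      also have "\<dots> = \<alpha> z * \<beta> z + of_int (int d) * \<gamma> z"
        by (simp add: \<beta>_def \<gamma>_def U_def V_def d'(1) algebra_simps)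
      finally show ?thesis .
    qed
    ultimately have "cyccong (int d) (\<lambda>z. cnj (\<alpha> z)) (\<lambda>z. \<alpha> z * \<beta> z)"
      by (intro cyccongI[of \<gamma>])
    then show ?thesis using \<open>cycint \<beta>\<close> by blast
  qed
qed

text \<open>A congruence modulo the norm is already a divisibility: \<alpha> divides its norm N, so
  the error term is itself a multiple of \<alpha>. The sign of N appears because the modulus is its
  absolute value.\<close>

lemma dvd_cnj:
  assumes "cycint \<alpha>" "(\<Prod>z\<in>Z. \<alpha> z) = of_int N" "N \<noteq> 0"
    and "\<And>q. prime q \<Longrightarrow> int q dvd N \<Longrightarrow> q \<noteq> p \<and> (\<exists>h. n dvd q ^ h + 1)"
  obtains \<epsilon> where "cycint \<epsilon>" "\<And>z. z \<in> Z \<Longrightarrow> cnj (\<alpha> z) = \<alpha> z * \<epsilon> z"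
proof -
  obtain \<beta> where \<beta>: "cycint \<beta>" "cyccong (int (nat \<bar>N\<bar>)) (\<lambda>z. cnj (\<alpha> z)) (\<lambda>z. \<alpha> z * \<beta> z)"
    using dvd_cnj_mod[OF assms(1), of "nat \<bar>N\<bar>"] assms(3,4) by auto
  obtain \<gamma> where \<gamma>: "cycint \<gamma>" "\<And>z. z \<in> Z \<Longrightarrow> cnj (\<alpha> z) = \<alpha> z * \<beta> z + of_int (int (nat \<bar>N\<bar>)) * \<gamma> z"
    using \<beta>(2) unfolding cyccong_def by blast
  obtain g where g: "cycint g" "\<And>z. z \<in> Z \<Longrightarrow> \<alpha> z * g z = of_int N"
    using cycint_norm_multiple[OF assms(1)] assms(2) by metis
  define \<epsilon> where "\<epsilon> z = \<beta> z + of_int (sgn N) * g z * \<gamma> z" for z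
  have "cycint \<epsilon>" unfolding \<epsilon>_def by (intro cycint_intros \<beta>(1) \<gamma>(1) g(1))
  moreover have "cnj (\<alpha> z) = \<alpha> z * \<epsilon> z" if "z \<in> Z" for z
  proof -
    have "of_int (int (nat \<bar>N\<bar>)) = (of_int (sgn N) * of_int N :: complex)"
      using abs_sgn[of N] by (simp add: mult.commute flip: of_int_mult)
    then show ?thesis
      using \<gamma>(2)[OF that] by (simp add: \<epsilon>_def flip: g(2)[OF that]) (simp add: algebra_simps)
  qed
  ultimately show thesis using that by blast
qed

section \<open>Norms and residue degrees; elements of absolute value 1\<close>

lemma n_gt_1: "n > 1"
  using i_pos prime_gt_1_nat[OF prime_p] by (intro one_less_power) auto

text \<open>With $\eta$ the product of $\alpha$ over representatives modulo the decomposition group $\langle q\rangle$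
  of order $f$, the norm of $\alpha$ is a multiple of $\eta^f$ modulo $q^f$ and a power of $\eta$ modulo $q$.\<close>

lemma norm_divisible_by_residue_norm:
  assumes "prime q" "q \<noteq> p" "cycint \<alpha>" "(\<Prod>z\<in>Z. \<alpha> z) = of_int N" "int q dvd N"
  shows "int (q ^ ord n q) dvd N"
proof -
  note [cycint_intros] = assms(3)
  have cop: "coprime q p" using assms(1,2) coprime_prime by blast
  have copn: "coprime q n" using cop coprime_n_iff by blast
  have q2: "q \<ge> 2" using assms(1) prime_ge_2_nat by blast
  define f where "f = ord n q"
  have f: "f > 0" using copn by (simp add: f_def coprime_commute)
  obtain S where S: "S \<subseteq> totatives n"
    "bij_betw (\<lambda>(a, k). a * q ^ k mod n) (S \<times> {..<f}) (totatives n)"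
    using powers_transversal[OF copn n_gt_1] unfolding f_def by blast
  have copS: "coprime a p" if "a \<in> S" for a using S(1) that coprime_totatives by blast
  define \<delta> where "\<delta> z = (\<Prod>k<f. \<alpha> (z ^ (q ^ k)))" for z
  define \<eta> where "\<eta> z = (\<Prod>a\<in>S. \<alpha> (z ^ a))" for z
  have c\<eta>: "cycint \<eta>" unfolding \<eta>_def using copS by (intro cycint_prod cycint_galois assms(3))
  note [cycint_intros] = c\<eta>
  have N: "of_int N = (\<Prod>a\<in>S. \<delta> (z ^ a))" if z: "z \<in> Z" for z
  proof -
    have "of_int N = (\<Prod>b\<in>totatives n. \<alpha> (z ^ b))"
      using prod_Z_galois[OF z, of \<alpha>] assms(4) by simp
    also have "\<dots> = (\<Prod>x\<in>S \<times> {..<f}. \<alpha> (z ^ (case x of (a, k) \<Rightarrow> a * q ^ k mod n)))"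
      using prod.reindex_bij_betw[OF S(2), of "\<lambda>b. \<alpha> (z ^ b)"] by simp
    also have "\<dots> = (\<Prod>(a, k)\<in>S \<times> {..<f}. \<alpha> ((z ^ a) ^ (q ^ k)))"
    proof (rule prod.cong)
      fix x assume "x \<in> S \<times> {..<f}"
      obtain a k where x: "x = (a, k)" by force
      have "z ^ (a * q ^ k mod n) = z ^ (a * q ^ k)"
        using Z_power_eq_iff[OF z] by simp
      then show "\<alpha> (z ^ (case x of (a, k) \<Rightarrow> a * q ^ k mod n)) = (case x of (a, k) \<Rightarrow> \<alpha> ((z ^ a) ^ (q ^ k)))"
        by (simp add: x power_mult)
    qed simp
    also have "\<dots> = (\<Prod>a\<in>S. \<delta> (z ^ a))"
      unfolding \<delta>_def by (rule prod.cartesian_product[symmetric])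
    finally show ?thesis .
  qed
  \<comment> \<open>\<delta> is the local norm along the decomposition group; a congruence for it
    carries over to N by multiplying its conjugates over the representatives in
    \<open>S\<close>.\<close>
  have gal_prod: "cyccong r (\<lambda>z. of_int N) (\<lambda>z. \<Prod>a\<in>S. g (z ^ a))"
    if "cyccong r \<delta> g" "cycint g" for r g
  proof -
    have "cyccong r (\<lambda>z. of_int N) (\<lambda>z. \<Prod>a\<in>S. \<delta> (z ^ a))" using N by (rule cyccong_eq)
    also have "cyccong r (\<lambda>z. \<Prod>a\<in>S. \<delta> (z ^ a)) (\<lambda>z. \<Prod>a\<in>S. g (z ^ a))"
      using that copS by (intro cyccong_prod cyccong_galois cycint_galois)
    finally show ?thesis .
  qed
  have "\<forall>k. \<exists>\<beta>. cycint \<beta> \<and> cyccong (int q ^ f) (\<lambda>z. \<alpha> (z ^ (q ^ k))) (\<lambda>z. \<alpha> z * \<beta> z)"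
    using dvd_frobenius_power_conjugate[OF assms(1-3)] by blast
  then obtain B where B: "\<And>k. cycint (B k)"
    "\<And>k. cyccong (int q ^ f) (\<lambda>z. \<alpha> (z ^ (q ^ k))) (\<lambda>z. \<alpha> z * B k z)" by metis
  define B' where "B' z = (\<Prod>k<f. B k z)" for z
  have cB': "cycint B'" unfolding B'_def by (intro cycint_intros B)
  note [cycint_intros] = B(1) cB'
  have "cyccong (int q ^ f) \<delta> (\<lambda>z. \<Prod>k<f. \<alpha> z * B k z)"
    unfolding \<delta>_def by (intro cyccong_prod B cycint_intros)
  also have "(\<lambda>z. \<Prod>k<f. \<alpha> z * B k z) = (\<lambda>z. \<alpha> z ^ f * B' z)"
    by (simp add: prod.distrib B'_def)
  finally have "cyccong (int q ^ f) (\<lambda>z. of_int N) (\<lambda>z. \<Prod>a\<in>S. \<alpha> (z ^ a) ^ f * B' (z ^ a))"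
    by (intro gal_prod cycint_intros)
  also have "(\<lambda>z. \<Prod>a\<in>S. \<alpha> (z ^ a) ^ f * B' (z ^ a)) = (\<lambda>z. \<eta> z ^ f * (\<Prod>a\<in>S. B' (z ^ a)))"
    by (simp add: prod.distrib \<eta>_def prod_power_distrib)
  finally have main: "cyccong (int q ^ f) (\<lambda>z. of_int N) (\<lambda>z. \<eta> z ^ f * (\<Prod>a\<in>S. B' (z ^ a)))" .
  \<comment> \<open>The exponent of the norm map of a field with q^f elements: \<delta> is congruent
    to \<alpha>^s modulo q.\<close>
  define s where "s = (\<Sum>k<f. q ^ k)"
  have "cyccong (int q) \<delta> (\<lambda>z. \<Prod>k<f. \<alpha> z ^ (q ^ k))"
    unfolding \<delta>_def using assms by (intro cyccong_prod frobenius_power cycint_intros)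
  also have "(\<lambda>z. \<Prod>k<f. \<alpha> z ^ (q ^ k)) = (\<lambda>z. \<alpha> z ^ s)"
    by (simp add: s_def power_sum)
  finally have "cyccong (int q) (\<lambda>z. of_int N) (\<lambda>z. \<Prod>a\<in>S. \<alpha> (z ^ a) ^ s)"
    by (intro gal_prod cycint_intros)
  then have "cyccong (int q) (\<lambda>z. of_int N) (\<lambda>z. \<eta> z ^ s)"
    by (simp add: \<eta>_def prod_power_distrib)
  then have "cyccong (int q) (\<lambda>z. \<eta> z ^ s) (\<lambda>z. of_int N)" by (rule cyccong_sym)
  also have "cyccong (int q) (\<lambda>z. of_int N) (\<lambda>z. 0)"
  proof -
    obtain c where "N = int q * c" using assms(5) by blast
    then show ?thesis by (intro cyccongI[OF cycint_of_int[of c]]) simp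
  qed
  finally have \<eta>s: "cyccong (int q) (\<lambda>z. \<eta> z ^ s) (\<lambda>z. 0)" .
  \<comment> \<open>There are no nilpotents modulo q: \<eta> is congruent to its power with exponent
    q^(f s), and this exponent is at least s, so \<eta>^s = 0 modulo q forces \<eta> = 0 modulo
    q.\<close>
  have "s \<le> q ^ (f * s)"
  proof -
    have "s < 2 ^ s" by simp
    also have "(2::nat) ^ s \<le> 2 ^ (f * s)" using f by (intro power_increasing) auto
    also have "\<dots> \<le> q ^ (f * s)" using q2 by (rule power_mono) simp
    finally show ?thesis by simp
  qed
  have "cyccong (int q) \<eta> (\<lambda>z. \<eta> (z ^ (q ^ (f * s))))"
  proof (rule cyccong_eq)
    fix z assume z: "z \<in> Z"
    have "[q ^ (f * s) = 1] (mod n)"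
      using ord_divides[of q "f * s" n] by (simp add: f_def)
    then show "\<eta> z = \<eta> (z ^ (q ^ (f * s)))" using Z_power_eq_iff[OF z, of "q ^ (f * s)" 1] by simp
  qed
  also have "cyccong (int q) (\<lambda>z. \<eta> (z ^ (q ^ (f * s)))) (\<lambda>z. \<eta> z ^ (q ^ (f * s)))"
    using assms by (intro frobenius_power c\<eta>)
  also have "(\<lambda>z. \<eta> z ^ (q ^ (f * s))) = (\<lambda>z. \<eta> z ^ s * \<eta> z ^ (q ^ (f * s) - s))"
    using \<open>s \<le> q ^ (f * s)\<close> by (simp flip: power_add)
  also have "cyccong (int q) \<dots> (\<lambda>z. 0 * \<eta> z ^ (q ^ (f * s) - s))"
    using \<eta>s by (intro cyccong_mult cyccong_refl cycint_intros)
  finally obtain \<theta> where \<theta>: "cycint \<theta>" "\<And>z. z \<in> Z \<Longrightarrow> \<eta> z = of_int (int q) * \<theta> z"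
    by (auto simp: cyccong_def)
  have "cyccong (int q ^ f) (\<lambda>z. \<eta> z ^ f * (\<Prod>a\<in>S. B' (z ^ a))) (\<lambda>z. 0)"
  proof (rule cyccongI)
    show "cycint (\<lambda>z. \<theta> z ^ f * (\<Prod>a\<in>S. B' (z ^ a)))"
      using copS by (intro cycint_intros \<theta>(1) cycint_galois)
  qed (simp add: \<theta>(2) power_mult_distrib)
  from cyccong_trans[OF main this] have "int q ^ f dvd N" by (rule cyccong_const_dvd)
  then show ?thesis by (simp add: f_def)
qed

text \<open>A quantitative substitute for Kronecker's theorem: adding multiples of the cyclotomic polynomial
  makes the coefficient sums over residue classes modulo $p^{i-1}$ small, and then Parseval's identity
  on the $p^i$-th and $p^{i-1}$-th roots of unity leaves a single coefficient.\<close>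

lemma cycint_norm_1_imp_monomial:
  assumes "cycint f" "\<And>z. z \<in> Z \<Longrightarrow> norm (f z) = 1"
  obtains s k where "s = 1 \<or> s = -1" "\<And>z. z \<in> Z \<Longrightarrow> f z = of_int s * z ^ k"
proof -
  obtain F where F: "\<forall>z\<in>Z. f z = ev F z" using assms(1) by (auto simp: cycint_def)
  obtain Q R where QR: "F = cyclotomic p i * Q + R" "R = 0 \<or> degree R < degree (cyclotomic p i)"
    using monic_division[OF monic_cyclotomic] by metis
  define h where "h = (p - 1) div 2"
  have ph: "p = 2 * h + 1" using odd_p by (auto simp: h_def elim!: oddE)
  have "degree (cyclotomic p i) < n"
    unfolding degree_cyclotomic n_eq using m_pos p_ge_3 by (intro mult_strict_left_mono) auto
  then have "degree R < n" using QR(2) n_pos by auto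
  define c where "c = coeff R"
  define S where "S r = (\<Sum>l<p. c (r + m * l))" for r
  \<comment> \<open>S r / p rounded to the nearest integer. Subtracting it from each of the p
    coefficients in the class of r changes F only by a multiple of the cyclotomic polynomial and
    replaces S r by its residue of least absolute value, at most h.\<close>
  define d where "d r = (S r + int h) div int p" for r
  define c' where "c' j = c j - d (j mod m)" for j
  define S' where "S' r = (\<Sum>l<p. c' (r + m * l))" for r
  have f_eq: "f z = (\<Sum>j<n. of_int (c' j) * z ^ j)" if z: "z \<in> Z" for z
  proof -
    have "f z = ev R z" using F QR(1) z cyclotomic_Z[OF z] by simp
    also have "\<dots> = (\<Sum>j<n. of_int (c j) * z ^ j)"
      unfolding ev_eq_sum c_def using \<open>degree R < n\<close>
      by (intro sum.mono_neutral_left) (auto intro: coeff_eq_0)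
    also have "\<dots> = (\<Sum>j<n. of_int (c' j) * z ^ j) + (\<Sum>j<n. of_int (d (j mod m)) * z ^ j)"
      by (simp add: c'_def algebra_simps flip: sum.distrib)
    also have "(\<Sum>j<n. of_int (d (j mod m)) * z ^ j) =
      (\<Sum>r<m. \<Sum>l<p. of_int (d ((r + m * l) mod m)) * z ^ (r + m * l))"
      unfolding n_eq by (rule sum_lessThan_mult)
    also have "\<dots> = (\<Sum>r<m. of_int (d r) * z ^ r * ev (cyclotomic p i) z)"
      by (intro sum.cong) (auto simp: cyclotomic_def sum_distrib_left power_add mult.assoc)
    also have "\<dots> = 0" using cyclotomic_Z[OF z] by simp
    finally show ?thesis by simp
  qed
  have S'_eq: "S' r = S r - int p * d r" if "r < m" for r
    using that by (simp add: S'_def S_def c'_def sum_subtractf)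
  have S'_le: "\<bar>S' r\<bar> \<le> int h" if "r < m" for r
  proof -
    have "S' r = (S r + int h) mod int p - int h"
      using S'_eq[OF that] minus_mult_div_eq_mod[of "S r + int h" "int p"] by (simp add: d_def)
    moreover have "0 \<le> (S r + int h) mod int p" "(S r + int h) mod int p < int p"
      using ph by simp_all
    ultimately show ?thesis using ph by linarith
  qed
  define T where "T = (\<Sum>j<n. (c' j)\<^sup>2)"
  define E where "E z = (\<Sum>j<n. of_int (c' j) * z ^ j)" for z :: complex
  have "(\<Sum>z | z ^ n = 1. (cmod (E z))\<^sup>2) = real n * real_of_int T"
    unfolding E_def T_def by (simp add: parseval_roots_of_unity)
  moreover have "(\<Sum>z | z ^ m = 1. (cmod (E z))\<^sup>2) = real m * real_of_int (\<Sum>r<m. (S' r)\<^sup>2)"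
  proof -
    have "E z = (\<Sum>r<m. of_int (S' r) * z ^ r)" if "z ^ m = 1" for z
    proof -
      have "E z = (\<Sum>r<m. \<Sum>l<p. of_int (c' (r + m * l)) * z ^ (r + m * l))"
        unfolding E_def n_eq by (rule sum_lessThan_mult)
      then show ?thesis using that
        by (simp add: S'_def sum_distrib_right power_add power_mult)
    qed
    then show ?thesis by (simp add: parseval_roots_of_unity)
  qed
  moreover have "(\<Sum>z | z ^ n = 1. (cmod (E z))\<^sup>2) =
     (\<Sum>z\<in>Z. (cmod (E z))\<^sup>2) + (\<Sum>z | z ^ m = 1. (cmod (E z))\<^sup>2)"
    unfolding Z_subset using m_roots_subset n_pos finite_roots_unity[of n]
    by (intro sum.subset_diff) auto
  moreover have "(\<Sum>z\<in>Z. (cmod (E z))\<^sup>2) = real (card Z)"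
    using assms(2) f_eq by (simp add: E_def)
  ultimately have "real n * real_of_int T = real (card Z) + real m * real_of_int (\<Sum>r<m. (S' r)\<^sup>2)"
    by simp
  then have "real m * (real p * real_of_int T) = real m * (real (p - 1) + real_of_int (\<Sum>r<m. (S' r)\<^sup>2))"
    by (simp only: n_eq card_Z of_nat_mult distrib_left mult.assoc)
  then have "real p * real_of_int T = real (p - 1) + real_of_int (\<Sum>r<m. (S' r)\<^sup>2)"
    using m_pos by (subst (asm) mult_cancel_left) auto
  then have "real_of_int (int p * T) = real_of_int (int (p - 1) + (\<Sum>r<m. (S' r)\<^sup>2))"
    by (simp only: of_int_add of_int_mult of_int_of_nat_eq)
  then have pT: "int p * T = int (p - 1) + (\<Sum>r<m. (S' r)\<^sup>2)"
    by (simp only: of_int_eq_iff)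
  \<comment> \<open>One factor |S' r| is bounded by h, the other by the sum of squares in its class,
    as |x| \<le> x^2 for integers.\<close>
  have "(\<Sum>r<m. (S' r)\<^sup>2) \<le> (\<Sum>r<m. \<Sum>l<p. int h * (c' (r + m * l))\<^sup>2)"
  proof (rule sum_mono)
    fix r assume "r \<in> {..<m}"
    then have "r < m" by simp
    have "(S' r)\<^sup>2 = \<bar>S' r\<bar> * \<bar>S' r\<bar>" by (simp add: power2_eq_square)
    also have "\<dots> \<le> int h * \<bar>S' r\<bar>" using S'_le[OF \<open>r < m\<close>] by (intro mult_right_mono) auto
    also have "\<bar>S' r\<bar> \<le> (\<Sum>l<p. \<bar>c' (r + m * l)\<bar>)" unfolding S'_def by (rule sum_abs)
    also have "\<dots> \<le> (\<Sum>l<p. (c' (r + m * l))\<^sup>2)"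
    proof (rule sum_mono)
      fix l
      have "\<bar>x\<bar> \<le> x\<^sup>2" for x :: int
      proof (cases "x = 0")
        case False
        then have "\<bar>x\<bar> * 1 \<le> \<bar>x\<bar> * \<bar>x\<bar>" by (intro mult_left_mono) auto
        then show ?thesis by (simp add: power2_eq_square)
      qed simp
      then show "\<bar>c' (r + m * l)\<bar> \<le> (c' (r + m * l))\<^sup>2" .
    qed
    finally show "(S' r)\<^sup>2 \<le> (\<Sum>l<p. int h * (c' (r + m * l))\<^sup>2)"
      by (simp add: sum_distrib_left mult_left_mono)
  qed
  also have "\<dots> = int h * T"
    unfolding T_def n_eq sum_lessThan_mult by (simp add: sum_distrib_left)
  finally have "int p * T \<le> int (p - 1) + int h * T" using pT by simp
  \<comment> \<open>With p = 2h + 1 the coefficient p - h is h + 1 and p - 1 is 2h; the quotient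
    2h/(h+1) is below 2, leaving T = 1 as the only positive value.\<close>
  then have "(int h + 1) * T \<le> 2 * int h" using ph by (simp add: algebra_simps)
  also have "\<dots> < (int h + 1) * 2" by simp
  finally have "T < 2" by (subst (asm) mult_less_cancel_left_pos) auto
  moreover have "T \<ge> 0" unfolding T_def by (intro sum_nonneg) auto
  moreover have "T \<noteq> 0"
  proof
    assume "T = 0"
    moreover have "(\<Sum>r<m. (S' r)\<^sup>2) \<ge> 0" by (intro sum_nonneg) auto
    ultimately show False using pT p_ge_3 by simp
  qed
  ultimately have "(\<Sum>j<n. (c' j)\<^sup>2) = 1" by (simp add: T_def)
  then obtain k where k: "k \<in> {..<n}" "c' k = 1 \<or> c' k = -1"
    "\<And>y. y \<in> {..<n} \<Longrightarrow> y \<noteq> k \<Longrightarrow> c' y = 0"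
    using sum_squares_int_eq_1[of "{..<n}"] by blast
  show thesis
  proof (rule that[OF k(2)])
    fix z assume z: "z \<in> Z"
    have "f z = (\<Sum>j<n. if j = k then of_int (c' j) * z ^ j else 0)"
      unfolding f_eq[OF z] using k(3) by (intro sum.cong) auto
    then show "f z = of_int (c' k) * z ^ k" using k(1) by simp
  qed
qed

section \<open>Conjugation, reduction at the prime above p, and the norm at one level\<close>

text \<open>At half the order, q^h is a square root of 1 modulo an odd prime power. Since p cannot
  divide both q^h - 1 and q^h + 1, it is 1 or -1, and 1 contradicts the order.\<close>

lemma half_order_power:
  assumes "coprime q p" "even (ord n q)"
  shows "\<exists>h. n dvd q ^ h + 1"
proof
  define h where "h = ord n q div 2"
  have f: "ord n q = 2 * h" using assms(2) by (simp add: h_def)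
  have "ord n q > 0" using assms(1) coprime_n_iff by (simp add: coprime_commute)
  then have h: "h > 0" using f by simp
  have "[int q ^ (2 * h) = 1] (mod int n)"
    using ord[of q n] f by (metis cong_int_iff of_nat_1 of_nat_power)
  then have dvd: "int p ^ i dvd (int q ^ h - 1) * (int q ^ h + 1)"
    by (simp add: cong_iff_dvd_diff power_mult power2_eq_square algebra_simps)
  have pp: "prime (int p)" using prime_p by simp
  have "\<not> (int p dvd int q ^ h - 1 \<and> int p dvd int q ^ h + 1)"
  proof
    assume "int p dvd int q ^ h - 1 \<and> int p dvd int q ^ h + 1"
    then have "int p dvd (int q ^ h + 1) - (int q ^ h - 1)" by (blast intro: dvd_diff)
    moreover have "(int q ^ h + 1) - (int q ^ h - 1) = int 2" by simp
    ultimately have "int p dvd int 2" by (simp only:)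
    then have "p dvd 2" by (simp only: int_dvd_int_iff)
    then show False using p_ge_3 by (auto dest: dvd_imp_le)
  qed
  then have "coprime (int p ^ i) (int q ^ h - 1) \<or> coprime (int p ^ i) (int q ^ h + 1)"
    using prime_imp_coprime[OF pp] by (metis coprime_power_left_iff)
  then have "int p ^ i dvd int q ^ h + 1 \<or> int p ^ i dvd int q ^ h - 1"
    using dvd by (metis coprime_dvd_mult_left_iff coprime_dvd_mult_right_iff)
  moreover have "\<not> int p ^ i dvd int q ^ h - 1"
  proof
    assume "int p ^ i dvd int q ^ h - 1"
    then have "[int (q ^ h) = int 1] (mod int n)" by (simp add: cong_iff_dvd_diff)
    then have "[q ^ h = 1] (mod n)" by (simp only: cong_int_iff)
    then have "2 * h dvd h" using ord_divides[of q h n] f by simp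
    then show False using h by (auto dest: dvd_imp_le)
  qed
  ultimately have "int (p ^ i) dvd int (q ^ h + 1)" by (simp add: add.commute)
  then show "n dvd q ^ h + 1" by (simp only: int_dvd_int_iff)
qed

text \<open>The cyclotomic polynomial takes the value p at 1, so evaluation at 1 modulo p is well
  defined on Z[zeta]: it is the residue map at the prime above p.\<close>

lemma dvd_poly_1_if_vanishes:
  assumes "\<And>z. z \<in> Z \<Longrightarrow> ev P z = 0"
  shows "int p dvd poly P 1"
  using cyclotomic_dvd[OF assms] cyclotomic_1 by (auto elim!: dvdE)

text \<open>On \<open>Z\<close> the norm is the value of the product of the polynomials G(x^a), and
  each of these takes the value G(1) at 1: automorphisms act trivially on the residue field at
  p.\<close>

lemma norm_cong_poly_1:
  assumes "(\<Prod>z\<in>Z. ev G z) = of_int N"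
  shows "[N = poly G 1 ^ card Z] (mod int p)"
proof -
  define P where "P = (\<Prod>a\<in>totatives n. pcompose G (Polynomial.monom 1 a)) - [:N:]"
  have "ev P z = 0" if "z \<in> Z" for z
    using prod_Z_galois[OF that, of "ev G"] assms by (simp add: P_def)
  then have "int p dvd poly P 1" by (rule dvd_poly_1_if_vanishes)
  moreover have "poly P 1 = poly G 1 ^ card Z - N"
    using card_Z_eq_totient by (simp add: P_def poly_prod poly_pcompose poly_monom totient_def)
  ultimately have "int p dvd poly G 1 ^ card Z - N" by simp
  then show ?thesis by (metis cong_iff_dvd_diff cong_sym)
qed

text \<open>The quotient of conjugate and original has absolute value 1 on \<open>Z\<close>, hence
  is a signed power of z. Reduction at 1 decides the sign: a minus sign would give p | 2 G(1), hence
  p | N.\<close>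

lemma cnj_eq_power_mult:
  assumes "(\<Prod>z\<in>Z. ev G z) = of_int N" "\<not> int p dvd N" "\<not> odd_prime_power_divisor n N"
  obtains k where "\<And>z. z \<in> Z \<Longrightarrow> cnj (ev G z) = z ^ k * ev G z"
proof -
  have "N \<noteq> 0" using assms(2) by auto
  have q: "q \<noteq> p \<and> (\<exists>h. n dvd q ^ h + 1)" if "prime q" "int q dvd N" for q
  proof -
    have "q \<noteq> p" using that assms(2) by auto
    moreover have "int (q ^ ord n q) dvd N"
      using norm_divisible_by_residue_norm[OF that(1) \<open>q \<noteq> p\<close> cycint_ev assms(1) that(2)] .
    then have "even (ord n q)"
      using assms(3) that(1) ord[of q n] unfolding odd_prime_power_divisor_def by blast
    ultimately show ?thesis using half_order_power coprime_prime[OF that(1)] by blast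
  qed
  obtain \<epsilon> where \<epsilon>: "cycint \<epsilon>" "\<And>z. z \<in> Z \<Longrightarrow> cnj (ev G z) = ev G z * \<epsilon> z"
    using dvd_cnj[OF cycint_ev assms(1) \<open>N \<noteq> 0\<close> q] by blast
  have nz: "ev G z \<noteq> 0" if "z \<in> Z" for z
    using assms(1) \<open>N \<noteq> 0\<close> that finite_Z by (metis of_int_eq_0_iff prod_zero)
  have "norm (\<epsilon> z) = 1" if "z \<in> Z" for z
    using arg_cong[OF \<epsilon>(2)[OF that], of norm] nz[OF that] by (simp add: norm_mult)
  then obtain s k where sk: "s = 1 \<or> s = -1" "\<And>z. z \<in> Z \<Longrightarrow> \<epsilon> z = of_int s * z ^ k"
    using cycint_norm_1_imp_monomial[OF \<epsilon>(1)] by blast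
  define P where "P = pcompose G (Polynomial.monom 1 (n - 1)) - Polynomial.monom s k * G"
  have "ev P z = 0" if "z \<in> Z" for z
    using \<epsilon>(2)[OF that] sk(2)[OF that] cycint_cnj_arg[OF cycint_ev that, of G]
    by (simp add: P_def algebra_simps)
  then have "int p dvd poly P 1" by (rule dvd_poly_1_if_vanishes)
  moreover have "poly P 1 = (1 - s) * poly G 1"
    by (simp add: P_def poly_pcompose poly_monom algebra_simps)
  ultimately have dvd: "int p dvd (1 - s) * poly G 1" by simp
  have "s = 1"
  proof (rule ccontr)
    assume "s \<noteq> 1"
    then have "int p dvd int 2 * poly G 1" using sk(1) dvd by auto
    moreover have "\<not> int p dvd int 2"
      unfolding int_dvd_int_iff using p_ge_3 by (auto dest: dvd_imp_le)
    ultimately have "int p dvd poly G 1"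
      using prime_p by (metis prime_dvd_mult_iff prime_int_nat_transfer prime_nat_int_transfer)
    moreover have "card Z > 0" using Z_nonempty finite_Z by (simp add: card_gt_0_iff)
    ultimately have "int p dvd poly G 1 ^ card Z" by (simp add: dvd_power_iff dvd_trans[OF _ dvd_power])
    then have "int p dvd N" using norm_cong_poly_1[OF assms(1)] by (metis cong_dvd_iff)
    then show False using assms(2) by simp
  qed
  then show thesis using that[of k] \<epsilon>(2) sk(2) by (simp add: mult.commute)
qed

text \<open>For odd p the sum of all k < p is divisible by p. Consequently, correcting a quotient by
  a multiple of the cyclotomic one leaves its value at 1 unchanged modulo p.\<close>

lemma dvd_pderiv_cyclotomic_1: "int p dvd poly (pderiv (cyclotomic p i)) 1"
proof -
  have "poly (pderiv (cyclotomic p i)) 1 = (\<Sum>k<p. int (m * k))"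
    by (simp add: cyclotomic_def pderiv_sum pderiv_monom poly_sum poly_monom)
  also have "\<dots> = int (m * (\<Sum>k<p. k))" by (simp add: sum_distrib_left)
  also have "(\<Sum>k<p. k) = p * ((p - 1) div 2)"
    using odd_p by (simp add: Sum_Ico_nat atLeast0LessThan[symmetric] div_mult_swap)
  finally show ?thesis by simp
qed

text \<open>On \<open>Z\<close> the cyclotomic relation exhibits p as a multiple of z - 1, so the
  constant term p u in the expansion of F at 1 can be absorbed into the quotient.\<close>

lemma uniformizer_dvd:
  assumes "int p dvd poly F 1"
  obtains G where "\<And>z. z \<in> Z \<Longrightarrow> ev F z = (z - 1) * ev G z"
    "[poly G 1 = poly (pderiv F) 1] (mod int p)"
proof -
  obtain u where u: "poly F 1 = int p * u" using assms by blast
  define G where "G = synthetic_div F 1 - Polynomial.smult u (synthetic_div (cyclotomic p i) 1)"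
  show thesis
  proof (rule that)
    fix z assume z: "z \<in> Z"
    have *: "(z - 1) * ev (synthetic_div (cyclotomic p i) 1) z = - of_nat p"
      using ev_synthetic_div[of "cyclotomic p i" z] cyclotomic_Z[OF z] cyclotomic_1
      by (simp add: eq_neg_iff_add_eq_0)
    have "(z - 1) * ev G z = (z - 1) * ev (synthetic_div F 1) z
        - of_int u * ((z - 1) * ev (synthetic_div (cyclotomic p i) 1) z)"
      by (simp add: G_def algebra_simps)
    then show "ev F z = (z - 1) * ev G z"
      unfolding ev_synthetic_div[of F z] u * by simp
  next
    have "poly G 1 = poly (pderiv F) 1 - u * poly (pderiv (cyclotomic p i)) 1"
      by (simp add: G_def poly_synthetic_div_1)
    then show "[poly G 1 = poly (pderiv F) 1] (mod int p)"
      using dvd_pderiv_cyclotomic_1 by (simp add: cong_iff_dvd_diff)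
  qed
qed

lemma norm_dvd_imp_dvd_poly_1:
  assumes "(\<Prod>z\<in>Z. ev F z) = of_int N" "int p dvd N"
  shows "int p dvd poly F 1"
proof -
  have "int p dvd poly F 1 ^ card Z"
    using norm_cong_poly_1[OF assms(1)] assms(2) by (metis cong_dvd_iff)
  then show ?thesis using prime_p by (metis prime_dvd_power prime_nat_int_transfer)
qed

text \<open>One factor p is the norm of z - 1; the other comes from the cofactor G, because G(1) is
  F'(1) modulo p.\<close>

lemma norm_ramified:
  assumes "int p dvd poly F 1" "int p dvd poly (pderiv F) 1"
  obtains N where "(\<Prod>z\<in>Z. ev F z) = of_int (int p ^ 2 * N)"
proof -
  obtain G where G: "\<And>z. z \<in> Z \<Longrightarrow> ev F z = (z - 1) * ev G z"
    "[poly G 1 = poly (pderiv F) 1] (mod int p)" using uniformizer_dvd[OF assms(1)] by blast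
  obtain N where N: "(\<Prod>z\<in>Z. ev G z) = of_int N"
    using cycint_norm[OF cycint_ev[of G]] by (auto elim: Ints_cases)
  have "int p dvd poly G 1" using G(2) assms(2) by (metis cong_dvd_iff)
  moreover have "card Z > 0" using Z_nonempty finite_Z by (simp add: card_gt_0_iff)
  ultimately have "int p dvd poly G 1 ^ card Z" by (simp add: dvd_trans[OF _ dvd_power])
  then have "int p dvd N" using norm_cong_poly_1[OF N] by (metis cong_dvd_iff)
  then obtain N' where "N = int p * N'" by blast
  then have "(\<Prod>z\<in>Z. ev F z) = of_int (int p ^ 2 * N')"
    using G(1) prod_Z_minus_1 N by (simp add: prod.distrib power2_eq_square)
  then show thesis by (rule that)
qed

lemma norm_uniformizer:
  assumes "int p dvd poly F 1" "\<not> int p dvd poly (pderiv F) 1"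
  obtains N where "(\<Prod>z\<in>Z. ev F z) = of_int (int p * N)" "\<not> int p dvd N"
    "odd_prime_power_divisor n N \<or> (\<exists>c. \<forall>z\<in>Z. cnj (ev F z) = - (z ^ c * ev F z))"
proof -
  obtain G where G: "\<And>z. z \<in> Z \<Longrightarrow> ev F z = (z - 1) * ev G z"
    "[poly G 1 = poly (pderiv F) 1] (mod int p)" using uniformizer_dvd[OF assms(1)] by blast
  obtain N where N: "(\<Prod>z\<in>Z. ev G z) = of_int N"
    using cycint_norm[OF cycint_ev[of G]] by (auto elim: Ints_cases)
  have pN: "\<not> int p dvd N"
  proof
    assume "int p dvd N"
    then have "int p dvd poly G 1" by (rule norm_dvd_imp_dvd_poly_1[OF N])
    then show False using G(2) assms(2) by (metis cong_dvd_iff)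
  qed
  show thesis
  proof (rule that)
    show "(\<Prod>z\<in>Z. ev F z) = of_int (int p * N)"
      using G(1) prod_Z_minus_1 N by (simp add: prod.distrib)
    show "\<not> int p dvd N" by (rule pN)
    show "odd_prime_power_divisor n N \<or> (\<exists>c. \<forall>z\<in>Z. cnj (ev F z) = - (z ^ c * ev F z))"
    proof (cases "odd_prime_power_divisor n N")
      case False
      then obtain k where k: "\<And>z. z \<in> Z \<Longrightarrow> cnj (ev G z) = z ^ k * ev G z"
        using cnj_eq_power_mult[OF N pN] by blast
      \<comment> \<open>Conjugating the uniformizer multiplies it by -z^(-1): this is the origin of
        the minus sign, and n - 1 represents the exponent -1.\<close>
      have "cnj (ev F z) = - (z ^ (k + (n - 1)) * ev F z)" if z: "z \<in> Z" for z
      proof -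
        have "z * cnj z = 1" using Z_norm[OF z] by (simp add: complex_norm_square[symmetric])
        then have "cnj (z - 1) = - (cnj z * (z - 1))" by (simp add: algebra_simps)
        then show ?thesis
          using G(1)[OF z] k[OF z] cnj_root_of_unity[OF Z_root[OF z] n_pos]
          by (simp add: power_add)
      qed
      then show ?thesis by blast
    qed simp
  qed
qed

end

section \<open>Circulant determinants as products over roots of unity\<close>

text \<open>Row r of the eigenvector equation: the vector of powers of an N-th root of unity is an
  eigenvector of the circulant, with eigenvalue the value of its polynomial.\<close>

lemma sum_mod_shift:
  fixes a :: "nat \<Rightarrow> 'a :: comm_semiring_1"
  assumes "r < N" "z ^ N = 1"
  shows "(\<Sum>s<N. a ((s + N - r) mod N) * z ^ s) = z ^ r * (\<Sum>j<N. a j * z ^ j)"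
proof -
  have zmod: "z ^ (k mod N) = z ^ k" for k
  proof -
    have "z ^ k = z ^ (N * (k div N) + k mod N)" by simp
    also have "\<dots> = (z ^ N) ^ (k div N) * z ^ (k mod N)" by (simp only: power_add power_mult)
    finally show ?thesis using assms(2) by simp
  qed
  have "(\<Sum>s<N. a ((s + N - r) mod N) * z ^ s) = (\<Sum>j<N. a j * z ^ ((j + r) mod N))"
  proof (rule sum.reindex_bij_witness[of _ "\<lambda>j. (j + r) mod N" "\<lambda>s. (s + N - r) mod N"])
    fix s assume "s \<in> {..<N}"
    then have s: "s < N" by simp
    have "((s + N - r) mod N + r) mod N = (s + N - r + r) mod N" by (rule mod_add_left_eq)
    also have "\<dots> = s" using s assms(1) by simp
    finally show e: "((s + N - r) mod N + r) mod N = s" .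
    show "(s + N - r) mod N \<in> {..<N}" using s by simp
    show "a ((s + N - r) mod N) * z ^ (((s + N - r) mod N + r) mod N) = a ((s + N - r) mod N) * z ^ s"
      using e by simp
  next
    fix j assume "j \<in> {..<N}"
    then have j: "j < N" by simp
    have "(j + r) mod N + N - r = (j + r) mod N + (N - r)" using assms(1) by simp
    then have "((j + r) mod N + N - r) mod N = (j + r + (N - r)) mod N"
      by (simp only: mod_add_left_eq)
    then show "((j + r) mod N + N - r) mod N = j" using j assms(1) by simp
    show "(j + r) mod N \<in> {..<N}" using j by simp
  qed
  then show ?thesis by (simp add: zmod power_add sum_distrib_left algebra_simps)
qed

definition associated_poly :: "nat \<Rightarrow> (nat \<Rightarrow> int) \<Rightarrow> int poly" where
  "associated_poly N a = (\<Sum>j<N. Polynomial.monom (a j) j)"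

lemma ev_associated_poly: "ev (associated_poly N a) z = (\<Sum>j<N. of_int (a j) * z ^ j)"
  by (simp add: associated_poly_def)

lemma det_mat_diag: "det (mat_diag N f) = (\<Prod>k<N. f k)"
proof -
  have "det (mat_diag N f) = prod_list (diag_mat (mat_diag N f))"
    by (rule det_upper_triangular[of _ N]) (auto simp: mat_diag_def upper_triangular_def)
  then show ?thesis by (simp add: prod_list_diag_prod mat_diag_def lessThan_atLeast0)
qed

text \<open>The Fourier matrix \<open>V\<close> diagonalizes the circulant. Orthogonality gives
  \<open>V * W\<close> = N times the identity, so \<open>det V\<close> is nonzero and
  cancels.\<close>

lemma det_circulant:
  assumes "N > 0"
  shows "of_int (det (circulant N a)) = (\<Prod>z | z ^ N = 1. ev (associated_poly N a) z)"
proof -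
  obtain w :: complex where w: "w ^ N = 1" "bij_betw (\<lambda>k. w ^ k) {..<N} {z. z ^ N = 1}"
    using primitive_root_of_unity[OF assms] by blast
  have wk: "(w ^ k) ^ N = 1" for k using w(1) by (metis mult.commute power_mult power_one)
  define C where "C = map_mat complex_of_int (circulant N a)"
  define V where "V = mat N N (\<lambda>(s, k). (w ^ k) ^ s)"
  define W where "W = mat N N (\<lambda>(k, s). cnj (w ^ k) ^ s)"
  define D where "D = mat_diag N (\<lambda>k. ev (associated_poly N a) (w ^ k))"
  have car: "C \<in> carrier_mat N N" "V \<in> carrier_mat N N" "W \<in> carrier_mat N N" "D \<in> carrier_mat N N"
    by (simp_all add: C_def V_def W_def D_def circulant_def mat_diag_def)
  have "V * W = mat_diag N (\<lambda>_. of_nat N)"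
  proof (rule eq_matI)
    fix r s assume rs: "r < dim_row (mat_diag N (\<lambda>_. of_nat N :: complex))"
      "s < dim_col (mat_diag N (\<lambda>_. of_nat N :: complex))"
    then have "r < N" "s < N" by (simp_all add: mat_diag_def)
    then have "(V * W) $$ (r, s) = (\<Sum>k<N. (w ^ k) ^ r * cnj (w ^ k) ^ s)"
      by (simp add: V_def W_def scalar_prod_def lessThan_atLeast0)
    also have "\<dots> = (\<Sum>z | z ^ N = 1. z ^ r * cnj z ^ s)"
      by (rule sum.reindex_bij_betw[OF w(2), of "\<lambda>z. z ^ r * cnj z ^ s"])
    also have "\<dots> = (if r = s then of_nat N else 0)"
      using \<open>r < N\<close> \<open>s < N\<close> by (rule sum_roots_of_unity_orthogonal)
    finally show "(V * W) $$ (r, s) = mat_diag N (\<lambda>_. of_nat N) $$ (r, s)"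
      using \<open>r < N\<close> \<open>s < N\<close> by (simp add: mat_diag_def)
  qed (simp_all add: V_def W_def mat_diag_def)
  then have "det V * det W = of_nat N ^ N"
    using det_mult[OF car(2,3)] by (simp add: det_mat_diag)
  then have nz: "det V \<noteq> 0" using assms by auto
  have "C * V = V * D"
  proof (rule eq_matI)
    fix r k assume "r < dim_row (V * D)" "k < dim_col (V * D)"
    then have rk: "r < N" "k < N" using car by auto
    have "(C * V) $$ (r, k) = (\<Sum>s<N. of_int (a ((s + N - r) mod N)) * (w ^ k) ^ s)"
      using rk by (simp add: C_def V_def circulant_def scalar_prod_def lessThan_atLeast0)
    also have "\<dots> = (w ^ k) ^ r * ev (associated_poly N a) (w ^ k)"
      using sum_mod_shift[OF rk(1) wk, of "\<lambda>j. of_int (a j)"] by (simp add: ev_associated_poly)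
    also have "\<dots> = (V * D) $$ (r, k)"
      unfolding D_def using rk by (subst mat_diag_mult_right[OF car(2)]) (simp add: V_def)
    finally show "(C * V) $$ (r, k) = (V * D) $$ (r, k)" .
  qed (use car in auto)
  then have "det C * det V = det V * det D"
    using det_mult[OF car(1,2)] det_mult[OF car(2,4)] by metis
  then have "det C = det D" using nz by simp
  also have "det D = (\<Prod>k<N. ev (associated_poly N a) (w ^ k))"
    by (simp add: D_def det_mat_diag)
  also have "\<dots> = (\<Prod>z | z ^ N = 1. ev (associated_poly N a) z)"
    by (rule prod.reindex_bij_betw[OF w(2)])
  finally show ?thesis by (simp add: C_def of_int_hom.hom_det)
qed

lemma roots_of_unity_prime_power:
  assumes "prime p"
  shows "{z :: complex. z ^ (p ^ t) = 1} = insert 1 (\<Union>i\<in>{1..t}. prim_roots p i)"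
proof (induction t)
  case (Suc t)
  have "{z :: complex. z ^ (p ^ Suc t) = 1} = prim_roots p (Suc t) \<union> {z. z ^ (p ^ t) = 1}"
    by (auto simp: prim_roots_def power_mult mult.commute[of p])
  moreover have "{1..Suc t} = insert (Suc t) {1..t}" by auto
  ultimately show ?case using Suc by auto
qed auto

lemma prim_roots_disjoint:
  assumes "i < j"
  shows "prim_roots p i \<inter> prim_roots p j = {}"
proof -
  have "z ^ (p ^ (j - 1)) = 1" if "z ^ (p ^ i) = 1" for z :: complex
  proof -
    have "p ^ (j - 1) = p ^ i * p ^ (j - 1 - i)" using assms by (simp flip: power_add)
    then show ?thesis using that by (simp add: power_mult)
  qed
  then show ?thesis by (auto simp: prim_roots_def)
qed

lemma det_circulant_prime_power:
  assumes "prime p" "odd p"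
  shows "of_int (det (circulant (p ^ t) a)) =
    ev (associated_poly (p ^ t) a) 1 *
    (\<Prod>i\<in>{1..t}. \<Prod>z\<in>prim_roots p i. ev (associated_poly (p ^ t) a) z)"
proof -
  have fin: "finite (prim_roots p i)" if "i \<in> {1..t}" for i
    using prime_power_roots.finite_Z[of p i] assms that by (simp add: prime_power_roots_def)
  have "of_int (det (circulant (p ^ t) a)) =
    (\<Prod>z\<in>insert 1 (\<Union>i\<in>{1..t}. prim_roots p i). ev (associated_poly (p ^ t) a) z)"
    using det_circulant[of "p ^ t" a] roots_of_unity_prime_power[OF assms(1), of t]
      prime_gt_0_nat[OF assms(1)] by simp
  also have "\<dots> = ev (associated_poly (p ^ t) a) 1 *
     (\<Prod>z\<in>(\<Union>i\<in>{1..t}. prim_roots p i). ev (associated_poly (p ^ t) a) z)"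
    using fin by (subst prod.insert) (auto simp: prim_roots_def)
  also have "(\<Prod>z\<in>(\<Union>i\<in>{1..t}. prim_roots p i). ev (associated_poly (p ^ t) a) z) =
     (\<Prod>i\<in>{1..t}. \<Prod>z\<in>prim_roots p i. ev (associated_poly (p ^ t) a) z)"
    using fin prim_roots_disjoint
    by (intro prod.UNION_disjoint) (auto simp: disjoint_iff, metis linorder_neqE_nat)
  finally show ?thesis .
qed

text \<open>The witness is F = k(1 + x + ... + x^(N-1)) + 1 - x with N = p^t. It is kN at 1 and 1 -
  z at the other roots, where each of the t levels contributes p.\<close>

lemma multiples_in_circ_dets:
  assumes "prime p" "odd p" "t \<ge> 1"
  shows "int p ^ (2 * t) * k \<in> circ_dets (p ^ t)"
proof -
  define N where "N = p ^ t"
  have N: "N \<ge> 2"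
    using assms prime_ge_2_nat[OF assms(1)] self_le_power[of p t] unfolding N_def by linarith
  define a where "a j = k + (if j = 0 then 1 else 0) - (if j = 1 then 1 else 0)" for j :: nat
  have ev_a: "ev (associated_poly N a) z = of_int k * (\<Sum>j<N. z ^ j) + (1 - z)" for z
  proof -
    have "ev (associated_poly N a) z =
      (\<Sum>j<N. of_int k * z ^ j + ((if j = 0 then z ^ j else 0) - (if j = 1 then z ^ j else 0)))"
      unfolding ev_associated_poly a_def by (intro sum.cong) (auto simp: algebra_simps)
    also have "\<dots> = of_int k * (\<Sum>j<N. z ^ j) + ((\<Sum>j<N. if j = 0 then z ^ j else 0) - (\<Sum>j<N. if j = 1 then z ^ j else 0))"
      by (simp only: sum.distrib sum_subtractf sum_distrib_left)
    also have "\<dots> = of_int k * (\<Sum>j<N. z ^ j) + (1 - z)" using N by (subst (1 2) sum.delta) auto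
    finally show ?thesis .
  qed
  have "(\<Prod>z\<in>prim_roots p i. ev (associated_poly N a) z) = of_nat p" if i: "i \<in> {1..t}" for i
  proof -
    interpret prime_power_roots p i using assms i by unfold_locales auto
    have "ev (associated_poly N a) z = 1 - z" if z: "z \<in> prim_roots p i" for z
    proof -
      have "N = p ^ i * p ^ (t - i)" using i by (simp add: N_def flip: power_add)
      then have "z ^ N = 1" using Z_root[OF z] by (simp add: power_mult)
      moreover have "z \<noteq> 1" using z by (auto simp: prim_roots_def)
      ultimately show ?thesis by (simp add: ev_a sum_gp_strict)
    qed
    then have "(\<Prod>z\<in>prim_roots p i. ev (associated_poly N a) z) = ev (cyclotomic p i) 1"
      by (simp add: cyclotomic_eq_prod)
    then show ?thesis by (simp add: ev_one_arg cyclotomic_1)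
  qed
  then have "of_int (det (circulant N a)) = (of_int k * of_nat N) * (of_nat p :: complex) ^ t"
    using det_circulant_prime_power[OF assms(1,2), of t a] ev_a[of 1] unfolding N_def by simp
  also have "\<dots> = of_int (int p ^ (2 * t) * k)"
    by (simp add: N_def power_add mult_2)
  finally have "det (circulant N a) = int p ^ (2 * t) * k" by (simp only: of_int_eq_iff)
  then show ?thesis unfolding circ_dets_def N_def by (metis (mono_tags, lifting) mem_Collect_eq)
qed

section \<open>Comparison of levels through the twisted trace\<close>

lemma prime_power_roots_at:
  assumes "prime p" "odd p" "i \<in> {1..t}"
  shows "prime_power_roots p i"
  using assms by unfold_locales auto

text \<open>Roots at different levels are disjoint, so together they number exactly the degree of
  the monic product.\<close>

lemma prod_cyclotomic_dvd:
  assumes "prime p" "odd p" "B \<subseteq> {1..t}" "\<And>k z. k \<in> B \<Longrightarrow> z \<in> prim_roots p k \<Longrightarrow> ev P z = 0"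
  shows "(\<Prod>k\<in>B. cyclotomic p k) dvd P"
proof -
  have loc: "prime_power_roots p k" if "k \<in> B" for k
    using assms that prime_power_roots_at by blast
  have fin: "finite B" using assms(3) finite_subset by blast
  have ne: "cyclotomic p k \<noteq> 0" if "k \<in> B" for k
    using prime_power_roots.monic_cyclotomic[OF loc[OF that]] by auto
  show ?thesis
  proof (rule monic_dvd_if_vanishes[of _ "\<Union>k\<in>B. prim_roots p k"])
    show "lead_coeff (\<Prod>k\<in>B. cyclotomic p k) = 1"
      using prime_power_roots.monic_cyclotomic[OF loc] by (simp add: lead_coeff_prod)
    show "finite (\<Union>k\<in>B. prim_roots p k)"
      using fin prime_power_roots.finite_Z[OF loc] by blast
    have "card (\<Union>k\<in>B. prim_roots p k) = (\<Sum>k\<in>B. card (prim_roots p k))"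
      using fin prime_power_roots.finite_Z[OF loc] prim_roots_disjoint
      by (intro card_UN_disjoint) (auto simp: disjoint_iff, metis linorder_neqE_nat)
    also have "\<dots> = (\<Sum>k\<in>B. degree (cyclotomic p k))"
      using prime_power_roots.card_Z[OF loc] prime_power_roots.degree_cyclotomic[OF loc]
      by (intro sum.cong) auto
    also have "\<dots> = degree (\<Prod>k\<in>B. cyclotomic p k)"
      using ne by (intro degree_prod_eq_sum_degree[symmetric]) auto
    finally show "card (\<Union>k\<in>B. prim_roots p k) = degree (\<Prod>k\<in>B. cyclotomic p k)" .
    show "ev (\<Prod>k\<in>B. cyclotomic p k) z = 0" if "z \<in> (\<Union>k\<in>B. prim_roots p k)" for z
      using that fin prime_power_roots.cyclotomic_Z[OF loc] by fastforce
    show "ev P z = 0" if "z \<in> (\<Union>k\<in>B. prim_roots p k)" for z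
      using that assms(4) by blast
  qed
qed

text \<open>A polynomial model of F(x^(-1)) + x^c F(x) on the N-th roots of unity, with N - 1 in
  place of the exponent -1.\<close>

definition twisted_trace :: "nat \<Rightarrow> nat \<Rightarrow> int poly \<Rightarrow> int poly" where
  "twisted_trace N c F = pcompose F (Polynomial.monom 1 (N - 1)) + Polynomial.monom 1 c * F"

lemma ev_twisted_trace:
  "z ^ N = 1 \<Longrightarrow> N > 0 \<Longrightarrow> ev (twisted_trace N c F) z = cnj (ev F z) + z ^ c * ev F z"
  using cnj_root_of_unity[of z N] ev_cnj[of F z] by (simp add: twisted_trace_def)

lemma poly_twisted_trace_1: "poly (twisted_trace N c F) 1 = 2 * poly F 1"
  by (simp add: twisted_trace_def poly_pcompose poly_monom)

lemma prim_roots_power_eq_1: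
  assumes "prime p" "odd p" "i \<in> {1..t}" "z \<in> prim_roots p i"
  shows "z ^ (p ^ t) = 1"
proof -
  have "p ^ t = p ^ i * p ^ (t - i)" using assms(3) by (simp flip: power_add)
  then show ?thesis using assms(4) by (simp add: prim_roots_def power_mult)
qed

text \<open>On lower primitive roots each factor $\Phi_{p^k}$ of the twisted trace takes the value $p$,
  while the norm of a nonzero $z^c-z^{c'}$ is at most $2^{\varphi(p^i)}$.\<close>

lemma twisted_trace_vanishes:
  assumes "prime p" "odd p" "i \<in> {1..t}" "B \<subseteq> {i<..t}"
    and van: "\<And>k z. k \<in> B \<Longrightarrow> z \<in> prim_roots p k \<Longrightarrow> ev (twisted_trace (p ^ t) c F) z = 0"
    and norm: "(\<Prod>z\<in>prim_roots p i. ev F z) = of_int (int p * M)" "\<not> int p dvd M"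
    and bad: "\<And>z. z \<in> prim_roots p i \<Longrightarrow> cnj (ev F z) = - (z ^ c' * ev F z)"
    and large: "2 ^ card (prim_roots p i) < p ^ (card B * card (prim_roots p i) - 1)"
    and z: "z \<in> prim_roots p i"
  shows "ev (twisted_trace (p ^ t) c F) z = 0"
proof (rule ccontr)
  assume nonzero: "ev (twisted_trace (p ^ t) c F) z \<noteq> 0"
  interpret prime_power_roots p i by (rule prime_power_roots_at[OF assms(1-3)])
  define P where "P = twisted_trace (p ^ t) c F"
  have P: "ev P w = (w ^ c - w ^ c') * ev F w" if "w \<in> Z" for w
    using ev_twisted_trace[OF prim_roots_power_eq_1[OF assms(1-3) that]] bad[OF that]
      prime_gt_0_nat[OF prime_p] by (simp add: P_def algebra_simps)
  \<comment> \<open>At level i the trace is F(w) times w^c - w^c'. Whether this difference vanishes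
    depends only on the exponents modulo p^i, so nonvanishing at one primitive root gives it at all
    of them.\<close>
  have "z ^ c \<noteq> z ^ c'" using nonzero P[OF z] by (auto simp: P_def)
  then have "\<not> [c = c'] (mod n)" using Z_power_eq_iff[OF z] by simp
  then have ne: "w ^ c - w ^ c' \<noteq> 0" if "w \<in> Z" for w using Z_power_eq_iff[OF that] by simp
  have "cycint (\<lambda>w. w ^ c - w ^ c')" by (intro cycint_intros)
  then obtain L where L: "(\<Prod>w\<in>Z. w ^ c - w ^ c') = of_int L"
    using cycint_norm by (metis Ints_cases)
  have "(\<Prod>w\<in>Z. w ^ c - w ^ c') \<noteq> 0" using ne finite_Z by (simp add: prod_zero_iff)
  then have "L \<noteq> 0" unfolding L by simp
  have "real_of_int \<bar>L\<bar> = (\<Prod>w\<in>Z. cmod (w ^ c - w ^ c'))"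
    using arg_cong[OF L, of cmod] by (simp add: prod_norm)
  also have "\<dots> \<le> (\<Prod>w\<in>Z. 2)"
  proof (rule prod_mono)
    fix w assume "w \<in> Z"
    then show "0 \<le> cmod (w ^ c - w ^ c') \<and> cmod (w ^ c - w ^ c') \<le> 2"
      using norm_triangle_ineq4[of "w ^ c" "w ^ c'"] Z_norm by (simp add: norm_power)
  qed
  finally have "real_of_int \<bar>L\<bar> \<le> real_of_int (2 ^ card Z)" by simp
  then have L_le: "\<bar>L\<bar> \<le> 2 ^ card Z" by (simp only: of_int_le_iff)
  have "B \<subseteq> {1..t}" using assms(4) by auto
  then have "(\<Prod>k\<in>B. cyclotomic p k) dvd P"
    unfolding P_def by (rule prod_cyclotomic_dvd[OF assms(1,2)]) (rule van)
  then obtain H where H: "P = (\<Prod>k\<in>B. cyclotomic p k) * H" by (elim dvdE)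
  have PH: "ev P w = of_nat p ^ card B * ev H w" if "w \<in> Z" for w
  proof -
    have "ev (cyclotomic p k) w = of_nat p" if k: "k \<in> B" for k
    proof -
      have "p ^ (k - 1) = p ^ i * p ^ (k - 1 - i)" using k assms(4) by (auto simp flip: power_add)
      then have "w ^ (p ^ (k - 1)) = 1" using Z_root[OF \<open>w \<in> Z\<close>] by (simp add: power_mult)
      moreover have "prime_power_roots p k"
        using k assms(4) by (intro prime_power_roots_at[OF assms(1,2), of k t]) auto
      ultimately show ?thesis by (rule prime_power_roots.cyclotomic_m_root[rotated])
    qed
    then show ?thesis by (simp add: H)
  qed
  obtain K where K: "(\<Prod>w\<in>Z. ev H w) = of_int K"
    using cycint_norm[OF cycint_ev[of H]] by (auto elim: Ints_cases)
  \<comment> \<open>One factor p is accounted for by the norm of F, the others must divide L. The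
    subtraction is not truncated, since \<open>large\<close> fails when the product is 0.\<close>
  define r where "r = card B * card Z - 1"
  have r: "card B * card Z = Suc r"
  proof (cases "card B * card Z")
    case 0
    then show ?thesis using large unfolding 0 by simp
  qed (simp add: r_def)
  have "of_int (L * (int p * M)) = (\<Prod>w\<in>Z. ev P w)"
    using P L norm(1) by (simp add: prod.distrib)
  also have "\<dots> = of_nat p ^ (card B * card Z) * of_int K"
    using PH K by (simp add: prod.distrib power_mult)
  also have "\<dots> = of_int (int p * (int p ^ r * K))" by (simp add: r mult.assoc)
  finally have "L * (int p * M) = int p * (int p ^ r * K)" by (simp only: of_int_eq_iff)
  then have "int p * (L * M) = int p * (int p ^ r * K)" by (simp only: ac_simps)
  then have "L * M = int p ^ r * K" using p_ge_3 by simp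
  moreover have "coprime (int p ^ r) M"
    using prime_imp_coprime[OF _ norm(2)] prime_p by simp
  ultimately have "int p ^ r dvd L" by (metis coprime_dvd_mult_left_iff dvd_triv_left)
  then have "int p ^ r \<le> \<bar>L\<bar>" using dvd_imp_le_int[of L "int p ^ r"] \<open>L \<noteq> 0\<close> by simp
  also note L_le
  finally have "int (p ^ r) \<le> int (2 ^ card Z)" by simp
  then have "p ^ r \<le> 2 ^ card Z" by (simp only: of_nat_le_iff)
  then show False using large by (simp add: r_def)
qed

text \<open>Here d is the number of primitive roots at a level. The bound starts with 8 < 9; for d =
  2 and p = 3 it would read 4 < 3.\<close>

lemma two_power_less:
  fixes p :: nat
  assumes "p \<ge> 3" "d \<ge> 3"
  shows "2 ^ d < p ^ (d - 1)"
proof -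
  have "2 ^ d < (3 :: nat) ^ (d - 1)"
    using assms(2)
  proof (induction d rule: dec_induct)
    case (step d)
    then have "2 * 2 ^ d < 3 * (3 :: nat) ^ (d - 1)" by simp
    also have "\<dots> = 3 ^ (Suc d - 1)" using step by (simp flip: power_Suc)
    finally show ?case by simp
  qed simp
  also have "\<dots> \<le> p ^ (d - 1)" using assms(1) by (rule power_mono) simp
  finally show ?thesis .
qed

lemma card_le_if_twisted_trace_vanishes:
  assumes "prime p" "odd p" "B \<subseteq> {1..t}"
    and "\<And>k z. k \<in> B \<Longrightarrow> z \<in> prim_roots p k \<Longrightarrow> ev (twisted_trace (p ^ t) c F) z = 0"
    and "poly F 1 = int p ^ a * b" "\<not> int p dvd b"
  shows "card B \<le> a"
proof -
  have "(\<Prod>k\<in>B. cyclotomic p k) dvd twisted_trace (p ^ t) c F"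
    by (rule prod_cyclotomic_dvd[OF assms(1-3)]) (rule assms(4))
  then obtain H where H: "twisted_trace (p ^ t) c F = (\<Prod>k\<in>B. cyclotomic p k) * H"
    by (elim dvdE)
  have "poly (cyclotomic p k) 1 = int p" if "k \<in> B" for k
    using that assms(3) prime_power_roots.cyclotomic_1[OF prime_power_roots_at[OF assms(1,2)]] by blast
  then have "2 * (int p ^ a * b) = int p ^ card B * poly H 1"
    using poly_twisted_trace_1[of "p ^ t" c F] assms(5) by (simp add: H poly_prod)
  then have "int p ^ card B dvd int p ^ a * (2 * b)" by (metis dvd_triv_left mult.left_commute)
  moreover have "\<not> int p dvd 2 * b"
  proof -
    have "\<not> p dvd 2" using assms(1,2) by (metis dvd_antisym dvd_imp_le even_numeral not_prime_1 order_antisym pos2 prime_ge_2_nat)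
    then have "\<not> int p dvd 2" by (metis int_dvd_int_iff of_nat_numeral)
    then show ?thesis using assms(1,6) by (metis prime_dvd_mult_iff prime_nat_int_transfer)
  qed
  then have "coprime (int p ^ card B) (2 * b)"
    using prime_imp_coprime[of "int p" "2 * b"] assms(1) by simp
  ultimately have "int p ^ card B dvd int p ^ a" by (metis coprime_dvd_mult_left_iff)
  then have "p ^ card B dvd p ^ a" by (metis int_dvd_int_iff of_nat_power)
  then show ?thesis using assms(1) prime_gt_1_nat by (metis power_dvd_imp_le)
qed

text \<open>The exponent c is taken from the highest level of \<open>B\<close>. That one level
  forces the trace to vanish at every lower level of \<open>B\<close> with at least three primitive
  roots. For p = 3, level 1 has only two and is treated last, with all the other levels of
  \<open>B\<close> above it; if these are fewer than two, then |B| \<le> 2 \<le> a already.\<close>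

lemma card_exceptional_levels_le:
  assumes "prime p" "odd p" "B \<subseteq> {1..t}"
    and norm: "\<And>i. i \<in> B \<Longrightarrow> (\<Prod>z\<in>prim_roots p i. ev F z) = of_int (int p * M i)"
      "\<And>i. i \<in> B \<Longrightarrow> \<not> int p dvd M i"
    and bad: "\<And>i. i \<in> B \<Longrightarrow> \<exists>c. \<forall>z\<in>prim_roots p i. cnj (ev F z) = - (z ^ c * ev F z)"
    and F1: "poly F 1 = int p ^ a * b" "\<not> int p dvd b"
    and cases: "p \<ge> 5 \<or> a \<ge> 2 \<or> 1 \<notin> B"
  shows "card B \<le> a"
proof (cases "B = {}")
  case False
  have p3: "p \<ge> 3" using assms(1,2) prime_ge_2_nat[of p] by (cases "p = 2") auto
  have fin: "finite B" using assms(3) finite_subset by blast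
  define k where "k = Max B"
  have kB: "k \<in> B" unfolding k_def using fin False by simp
  have k_max: "i \<le> k" if "i \<in> B" for i unfolding k_def using fin that by simp
  obtain c where c: "\<And>z. z \<in> prim_roots p k \<Longrightarrow> cnj (ev F z) = - (z ^ c * ev F z)"
    using bad[OF kB] by blast
  let ?P = "twisted_trace (p ^ t) c F"
  have van_k: "ev ?P z = 0" if "z \<in> prim_roots p k" for z
    using ev_twisted_trace[OF prim_roots_power_eq_1[OF assms(1,2) _ that]] c[OF that] kB assms(3)
      prime_gt_0_nat[OF assms(1)] by auto
  have card_Z: "card (prim_roots p i) = p ^ (i - 1) * (p - 1)" if "i \<in> B" for i
    using prime_power_roots.card_Z[OF prime_power_roots_at[OF assms(1,2)]] that assms(3) by blast
  have van: "ev ?P z = 0" if i: "i \<in> B" "p \<ge> 5 \<or> i \<noteq> 1" and z: "z \<in> prim_roots p i" for i z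
  proof (cases "i = k")
    case False
    then have "i < k" using k_max[OF i(1)] by simp
    obtain c' where c': "\<And>z. z \<in> prim_roots p i \<Longrightarrow> cnj (ev F z) = - (z ^ c' * ev F z)"
      using bad[OF i(1)] by blast
    have "card (prim_roots p i) \<ge> 3"
    proof (cases "p \<ge> 5")
      case True
      have "1 * (p - 1) \<le> p ^ (i - 1) * (p - 1)" using p3 by (intro mult_right_mono) auto
      then show ?thesis using True unfolding card_Z[OF i(1)] by linarith
    next
      case False
      then have "i \<noteq> 1" "i \<ge> 1" using i assms(3) by auto
      then have "i - 1 \<ge> 1" by simp
      then have "p ^ 1 \<le> p ^ (i - 1)" using p3 by (intro power_increasing) auto
      then have "3 * 2 \<le> p ^ (i - 1) * (p - 1)" using p3 by (intro mult_mono) auto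
      then show ?thesis unfolding card_Z[OF i(1)] by simp
    qed
    then have "2 ^ card (prim_roots p i) < p ^ (card {k} * card (prim_roots p i) - 1)"
      using two_power_less[OF p3] by simp
    moreover have "i \<in> {1..t}" "{k} \<subseteq> {i<..t}" using i(1) kB assms(3) \<open>i < k\<close> by auto
    moreover have "ev ?P z = 0" if "l \<in> {k}" "z \<in> prim_roots p l" for l z
      using that van_k by simp
    ultimately show ?thesis
      using twisted_trace_vanishes[OF assms(1,2) _ _ _ norm(1)[OF i(1)] norm(2)[OF i(1)] c' _ z, of t "{k}" c]
      by blast
  qed (use van_k z in simp)
  show ?thesis
  proof (cases "p \<ge> 5 \<or> 1 \<notin> B")
    case True
    have "ev ?P z = 0" if i: "i \<in> B" and z: "z \<in> prim_roots p i" for i z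
    proof (rule van[OF i _ z])
      show "p \<ge> 5 \<or> i \<noteq> 1" using True i by auto
    qed
    then show ?thesis by (rule card_le_if_twisted_trace_vanishes[OF assms(1-3) _ F1])
  next
    case False
    then have "1 \<in> B" "a \<ge> 2" "p < 5" using cases by auto
    then have "p = 3 \<or> p = 4" using p3 by linarith
    then have "p = 3" using assms(2) by auto
    show ?thesis
    proof (cases "card B \<le> 2")
      case False
      define B' where "B' = B - {1}"
      have "card B = Suc (card B')"
        unfolding B'_def using fin \<open>1 \<in> B\<close> by (metis card_Suc_Diff1)
      then have B': "card B' \<ge> 2" using False by simp
      obtain c' where c': "\<And>z. z \<in> prim_roots p 1 \<Longrightarrow> cnj (ev F z) = - (z ^ c' * ev F z)"
        using bad[OF \<open>1 \<in> B\<close>] by blast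
      have card1: "card (prim_roots p 1) = 2" using card_Z[OF \<open>1 \<in> B\<close>] \<open>p = 3\<close> by simp
      \<comment> \<open>At least two vanishing levels above level 1 raise the exponent to at least 2
        * 2 - 1 = 3, and 2^2 < 3^3.\<close>
      have "(3::nat) ^ 3 \<le> 3 ^ (card B' * 2 - 1)" using B' by (intro power_increasing) auto
      then have large: "2 ^ card (prim_roots p 1) < p ^ (card B' * card (prim_roots p 1) - 1)"
        unfolding card1 using \<open>p = 3\<close> by simp
      have sub: "1 \<in> {1..t}" "B' \<subseteq> {1<..t}" using assms(3) \<open>1 \<in> B\<close> by (auto simp: B'_def)
      have van': "ev ?P z = 0" if "i \<in> B'" "z \<in> prim_roots p i" for i z
        using van[of i z] that by (auto simp: B'_def)
      have "ev ?P z = 0" if "z \<in> prim_roots p 1" for z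
        using twisted_trace_vanishes[OF assms(1,2) sub van' norm(1)[OF \<open>1 \<in> B\<close>] norm(2)[OF \<open>1 \<in> B\<close>] c' large that] .
      then have "ev ?P z = 0" if "i \<in> B" "z \<in> prim_roots p i" for i z
        using that van[of i z] by (cases "i = 1") auto
      then show ?thesis by (rule card_le_if_twisted_trace_vanishes[OF assms(1-3) _ F1])
    qed (use \<open>a \<ge> 2\<close> in simp)
  qed
qed simp

section \<open>Selection of the prime powers and conclusion\<close>

text \<open>Greedy matching from the top: the largest element of G serves the last index, which it
  reaches because G has more than k elements, all at least s.\<close>

lemma ex_dominating_injection:
  fixes G :: "nat set"
  assumes "finite G" "G \<subseteq> {s..}" "k \<le> card G"
  shows "\<exists>l. inj_on l {s..<s + k} \<and> (\<forall>i\<in>{s..<s + k}. l i \<in> G \<and> i \<le> l i)"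
  using assms
proof (induction k arbitrary: G)
  case (Suc k)
  define M where "M = Max G"
  have "G \<noteq> {}" using Suc.prems(3) by auto
  then have M: "M \<in> G" using Suc.prems(1) by (simp add: M_def)
  have "G \<subseteq> {s..M}" using Suc.prems(1,2) by (auto simp: M_def)
  then have "card G \<le> card {s..M}" by (intro card_mono) auto
  then have sM: "s + k \<le> M" using Suc.prems(3) by simp
  have "k \<le> card (G - {M})" using Suc.prems(1,3) M by simp
  then obtain l where l: "inj_on l {s..<s + k}" "\<forall>i\<in>{s..<s + k}. l i \<in> G - {M} \<and> i \<le> l i"
    using Suc.IH[of "G - {M}"] Suc.prems(1,2) by (meson Diff_subset finite_Diff subset_trans)
  have eq: "{s..<s + Suc k} = insert (s + k) {s..<s + k}" by auto
  have "inj_on (l(s + k := M)) {s..<s + Suc k}"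
    unfolding eq inj_on_insert using l by (auto simp: inj_on_def)
  moreover have "\<forall>i\<in>{s..<s + Suc k}. (l(s + k := M)) i \<in> G \<and> i \<le> (l(s + k := M)) i"
    unfolding eq using l sM M by auto
  ultimately show ?case by blast
qed auto

text \<open>Index i borrows the prime power of a good level l i \<ge> i, whose congruence modulo
  p^(l i) implies the one modulo p^i. Injectivity of l places the borrowed powers in distinct
  factors of m.\<close>

lemma ex_prime_power_factors:
  assumes "\<And>i. i \<in> G \<Longrightarrow> odd_prime_power_divisor (p ^ i) (M i)"
    and "G \<subseteq> {s..t}" "s \<ge> 1" "k \<le> card G" "m = m0 * (\<Prod>i\<in>{1..t}. M i)"
  shows "\<exists>q e. (\<forall>i\<in>{s..<s + k}. prime (q i) \<and> odd (e i) \<and> [q i ^ e i = 1] (mod p ^ i))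
    \<and> (\<Prod>i\<in>{s..<s + k}. int (q i ^ e i)) dvd m"
proof -
  have "finite G" using assms(2) finite_subset by blast
  then obtain l where l: "inj_on l {s..<s + k}" "\<And>i. i \<in> {s..<s + k} \<Longrightarrow> l i \<in> G"
    "\<And>i. i \<in> {s..<s + k} \<Longrightarrow> i \<le> l i"
    using ex_dominating_injection[of G s k] assms(2,4) by (auto simp: subset_iff)
  obtain q e where qe: "\<And>i. i \<in> G \<Longrightarrow> prime (q i)" "\<And>i. i \<in> G \<Longrightarrow> odd (e i)"
    "\<And>i. i \<in> G \<Longrightarrow> [q i ^ e i = 1] (mod p ^ i)" "\<And>i. i \<in> G \<Longrightarrow> int (q i ^ e i) dvd M i"
    using assms(1) unfolding odd_prime_power_divisor_def by metis
  have "[q (l i) ^ e (l i) = 1] (mod p ^ i)" if "i \<in> {s..<s + k}" for i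
    using qe(3)[OF l(2)[OF that]] l(3)[OF that] by (meson cong_dvd_modulus_nat le_imp_power_dvd)
  moreover have "(\<Prod>i\<in>{s..<s + k}. int (q (l i) ^ e (l i))) dvd m"
  proof -
    have "(\<Prod>i\<in>{s..<s + k}. int (q (l i) ^ e (l i))) dvd (\<Prod>i\<in>{s..<s + k}. M (l i))"
      using qe(4) l(2) by (intro prod_dvd_prod) auto
    also have "\<dots> = (\<Prod>i\<in>l ` {s..<s + k}. M i)" using l(1) by (simp add: prod.reindex)
    also have "\<dots> dvd (\<Prod>i\<in>{1..t}. M i)"
    proof (rule prod_dvd_prod_subset)
      show "l ` {s..<s + k} \<subseteq> {1..t}" using l(2) assms(2,3) by fastforce
    qed simp
    also have "\<dots> dvd m" using assms(5) by simp
    finally show ?thesis .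
  qed
  ultimately show ?thesis
    using qe(1,2) l(2) by (intro exI[of _ "\<lambda>i. q (l i)"] exI[of _ "\<lambda>i. e (l i)"]) simp
qed

lemma circulant_determinant_factors:
  assumes "prime p" "odd p" "t + 1 \<le> j" "j \<le> 2 * t"
    and m: "\<not> int p dvd m" "int p ^ j * m \<in> circ_dets (p ^ t)"
  obtains F M b where "poly F 1 = int p ^ (j - t) * b" "\<not> int p dvd b" "m = b * (\<Prod>i\<in>{1..t}. M i)"
    "\<And>i. i \<in> {1..t} \<Longrightarrow> (\<Prod>z\<in>prim_roots p i. ev F z) = of_int (int p * M i)"
    "\<And>i. i \<in> {1..t} \<Longrightarrow> \<not> int p dvd M i"
    "\<And>i. i \<in> {1..t} \<Longrightarrow> odd_prime_power_divisor (p ^ i) (M i) \<or>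
      (\<exists>c. \<forall>z\<in>prim_roots p i. cnj (ev F z) = - (z ^ c * ev F z))"
proof -
  have pp: "prime (int p)" using assms(1) by simp
  have p0: "int p \<noteq> 0" using prime_gt_0_nat[OF assms(1)] by simp
  have loc: "prime_power_roots p i" if "i \<in> {1..t}" for i
    using assms(1,2) that by (rule prime_power_roots_at)
  obtain a where a: "det (circulant (p ^ t) a) = int p ^ j * m" using m(2) by (auto simp: circ_dets_def)
  define F where "F = associated_poly (p ^ t) a"
  have "\<exists>N. (\<Prod>z\<in>prim_roots p i. ev F z) = of_int N" if "i \<in> {1..t}" for i
    using prime_power_roots.cycint_norm[OF loc[OF that] prime_power_roots.cycint_ev[OF loc[OF that]]]
    by (metis Ints_cases)
  then obtain N where N: "\<And>i. i \<in> {1..t} \<Longrightarrow> (\<Prod>z\<in>prim_roots p i. ev F z) = of_int (N i)"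
    by metis
  have "of_int (int p ^ j * m) = (of_int (poly F 1 * (\<Prod>i\<in>{1..t}. N i)) :: complex)"
    using det_circulant_prime_power[OF assms(1,2), of t a] a N by (simp add: F_def[symmetric] ev_one_arg)
  then have D: "int p ^ j * m = poly F 1 * (\<Prod>i\<in>{1..t}. N i)" by (simp only: of_int_eq_iff)
  \<comment> \<open>Some factor of the determinant is divisible by p, and a level norm divisible by
    p forces p | F(1) by reduction at 1.\<close>
  have pF: "int p dvd poly F 1"
  proof -
    have "int p dvd int p ^ j * m" using assms(3) by simp
    then consider "int p dvd poly F 1" | i where "i \<in> {1..t}" "int p dvd N i"
      unfolding D using pp by (auto simp: prime_dvd_mult_iff prime_dvd_prod_iff)
    then show ?thesis
      using prime_power_roots.norm_dvd_imp_dvd_poly_1[OF loc N] by cases auto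
  qed
  \<comment> \<open>Otherwise each of the t levels contributes p^2 and F(1) one more p, giving
    p^(2t+1) in contradiction to j \<le> 2t.\<close>
  have np: "\<not> int p dvd poly (pderiv F) 1"
  proof
    assume dF: "int p dvd poly (pderiv F) 1"
    have "int p ^ 2 dvd N i" if i: "i \<in> {1..t}" for i
    proof -
      obtain N' where "(\<Prod>z\<in>prim_roots p i. ev F z) = of_int (int p ^ 2 * N')"
        using prime_power_roots.norm_ramified[OF loc[OF i] pF dF] by blast
      then have "N i = int p ^ 2 * N'" unfolding N[OF i] by (simp only: of_int_eq_iff)
      then show ?thesis by simp
    qed
    then have "(\<Prod>i\<in>{1..t}. int p ^ 2) dvd (\<Prod>i\<in>{1..t}. N i)" by (intro prod_dvd_prod) auto
    then have "int p * int p ^ (2 * t) dvd int p ^ j * m"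
      unfolding D using pF by (intro mult_dvd_mono) (simp_all add: power_mult)
    then have "int p ^ Suc (2 * t) dvd int p ^ j * m" by simp
    moreover have "coprime (int p ^ Suc (2 * t)) m"
      using prime_imp_coprime[OF pp m(1)] by (simp only: coprime_power_left_iff) simp
    ultimately have "int p ^ Suc (2 * t) dvd int p ^ j" by (metis coprime_dvd_mult_left_iff)
    then have "p ^ Suc (2 * t) dvd p ^ j" by (metis int_dvd_int_iff of_nat_power)
    then have "Suc (2 * t) \<le> j" using prime_gt_1_nat[OF assms(1)] by (metis power_dvd_imp_le)
    then show False using assms(4) by simp
  qed
  have "\<exists>M. (\<Prod>z\<in>prim_roots p i. ev F z) = of_int (int p * M) \<and> \<not> int p dvd M \<and>
      (odd_prime_power_divisor (p ^ i) M \<or>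
      (\<exists>c. \<forall>z\<in>prim_roots p i. cnj (ev F z) = - (z ^ c * ev F z)))" if "i \<in> {1..t}" for i
    by (rule prime_power_roots.norm_uniformizer[OF loc[OF that] pF np]) blast
  then obtain M where M: "\<And>i. i \<in> {1..t} \<Longrightarrow> (\<Prod>z\<in>prim_roots p i. ev F z) = of_int (int p * M i)"
    "\<And>i. i \<in> {1..t} \<Longrightarrow> \<not> int p dvd M i"
    "\<And>i. i \<in> {1..t} \<Longrightarrow> odd_prime_power_divisor (p ^ i) (M i) \<or>
      (\<exists>c. \<forall>z\<in>prim_roots p i. cnj (ev F z) = - (z ^ c * ev F z))"
    by metis
  have NM: "N i = int p * M i" if "i \<in> {1..t}" for i
    using M(1)[OF that] unfolding N[OF that] by (simp only: of_int_eq_iff)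
  define R where "R = (\<Prod>i\<in>{1..t}. M i)"
  have "(\<Prod>i\<in>{1..t}. N i) = int p ^ t * R" using NM by (simp add: prod.distrib R_def)
  moreover have "int p ^ j = int p ^ t * int p ^ (j - t)" using assms(3) by (simp flip: power_add)
  ultimately have "int p ^ t * (int p ^ (j - t) * m) = int p ^ t * (poly F 1 * R)"
    using D by (simp only: ac_simps)
  then have D': "int p ^ (j - t) * m = poly F 1 * R" using p0 by simp
  have "\<not> int p dvd R" unfolding R_def using M(2) pp by (simp add: prime_dvd_prod_iff)
  then have "coprime (int p ^ (j - t)) R" using prime_imp_coprime[OF pp] by simp
  then have "int p ^ (j - t) dvd poly F 1" using D' by (metis coprime_dvd_mult_left_iff dvd_triv_left)
  then obtain b where b: "poly F 1 = int p ^ (j - t) * b" by blast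
  then have "m = b * R" using D' p0 by simp
  moreover from this have "\<not> int p dvd b" using m(1) by auto
  ultimately show thesis using that[OF b _ _ M] by (simp add: R_def)
qed

theorem theorem1p1:
  fixes p t :: nat
  assumes "prime p"
    and "(p \<ge> 5 \<and> t \<ge> 2) \<or> (p = 3 \<and> t \<ge> 3)"
  shows "{int p ^ (2 * t) * k | k. True} \<subseteq> circ_dets (p ^ t)
    \<and> (\<forall>j. t + 1 \<le> j \<and> j \<le> 2 * t - 1 \<longrightarrow> int p ^ j \<notin> circ_dets (p ^ t))
    \<and> (\<forall>j m. t + 1 \<le> j \<and> j \<le> 2 * t - 1 \<and> \<not> int p dvd m \<and>
           int p ^ j * m \<in> circ_dets (p ^ t) \<longrightarrow>
           ((p \<ge> 5 \<or> (p = 3 \<and> j > t + 1)) \<longrightarrow>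
             (\<exists>q e. (\<forall>i\<in>{1..2 * t - j}. prime (q i) \<and> odd (e i)
                     \<and> [q i ^ e i = 1] (mod p ^ i))
                 \<and> (\<Prod>i\<in>{1..2 * t - j}. int (q i ^ e i)) dvd m))
         \<and> ((p = 3 \<and> j = t + 1) \<longrightarrow>
             (\<exists>q e. (\<forall>i\<in>{2..t - 1}. prime (q i) \<and> odd (e i)
                     \<and> [q i ^ e i = 1] (mod 3 ^ i))
                 \<and> (\<Prod>i\<in>{2..t - 1}. int (q i ^ e i)) dvd m)))"
proof -
  have odd: "odd p"
  proof
    assume "even p"
    then have "p = 2" using assms(1) by (metis primes_dvd_imp_eq two_is_prime_nat)
    then show False using assms(2) by simp
  qed
  \<comment> \<open>Of the t + 1 - s levels from s to t at most j - t are exceptional, which leaves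
    k = 2t + 1 - s - j good ones. Case (a) takes s = 1; case (b) takes s = 2 to avoid level
    1.\<close>
  have key: "\<exists>q e. (\<forall>i\<in>{s..<s + k}. prime (q i) \<and> odd (e i) \<and> [q i ^ e i = 1] (mod p ^ i))
      \<and> (\<Prod>i\<in>{s..<s + k}. int (q i ^ e i)) dvd m"
    if j: "t + 1 \<le> j" "j \<le> 2 * t - 1" and m: "\<not> int p dvd m" "int p ^ j * m \<in> circ_dets (p ^ t)"
      and s: "s \<ge> 1" "p \<ge> 5 \<or> j > t + 1 \<or> s > 1" and k: "s + k + j = 2 * t + 1" for j m s k
  proof -
    have "j \<le> 2 * t" using j(2) by simp
    obtain F M b where F: "poly F 1 = int p ^ (j - t) * b" "\<not> int p dvd b" "m = b * (\<Prod>i\<in>{1..t}. M i)"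
      and M: "\<And>i. i \<in> {1..t} \<Longrightarrow> (\<Prod>z\<in>prim_roots p i. ev F z) = of_int (int p * M i)"
      "\<And>i. i \<in> {1..t} \<Longrightarrow> \<not> int p dvd M i"
      "\<And>i. i \<in> {1..t} \<Longrightarrow> odd_prime_power_divisor (p ^ i) (M i) \<or>
      (\<exists>c. \<forall>z\<in>prim_roots p i. cnj (ev F z) = - (z ^ c * ev F z))"
      using circulant_determinant_factors[OF assms(1) odd j(1) \<open>j \<le> 2 * t\<close> m] by metis
    define G where "G = {i \<in> {s..t}. odd_prime_power_divisor (p ^ i) (M i)}"
    define B where "B = {s..t} - G"
    have B: "B \<subseteq> {1..t}" using s(1) by (auto simp: B_def)
    have "card B \<le> j - t"
    proof (rule card_exceptional_levels_le[OF assms(1) odd B _ _ _ F(1,2)])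
      show "\<exists>c. \<forall>z\<in>prim_roots p i. cnj (ev F z) = - (z ^ c * ev F z)" if "i \<in> B" for i
        using M(3)[of i] that s(1) by (auto simp: B_def G_def)
      show "p \<ge> 5 \<or> j - t \<ge> 2 \<or> 1 \<notin> B" using s(2) j(1) by (auto simp: B_def)
    qed (use M B in auto)
    moreover have "card B = card {s..t} - card G"
      unfolding B_def by (intro card_Diff_subset) (auto simp: G_def)
    moreover have "card {s..t} = t + 1 - s" by simp
    ultimately have "k \<le> card G" using k j by linarith
    then show ?thesis
      by (intro ex_prime_power_factors[where G = G and M = M and t = t and ?m0.0 = b] s(1) F(3))
         (auto simp: G_def)
  qed
  have multiples: "{int p ^ (2 * t) * k | k. True} \<subseteq> circ_dets (p ^ t)"
    using multiples_in_circ_dets[OF assms(1) odd] assms(2) by auto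
  have a: "\<exists>q e. (\<forall>i\<in>{1..2 * t - j}. prime (q i) \<and> odd (e i) \<and> [q i ^ e i = 1] (mod p ^ i))
                 \<and> (\<Prod>i\<in>{1..2 * t - j}. int (q i ^ e i)) dvd m"
    if "t + 1 \<le> j" "j \<le> 2 * t - 1" "\<not> int p dvd m" "int p ^ j * m \<in> circ_dets (p ^ t)"
      "p \<ge> 5 \<or> (p = 3 \<and> j > t + 1)" for j m
  proof -
    have "{1..2 * t - j} = {1..<1 + (2 * t - j)}" by auto
    then show ?thesis using key[OF that(1-4), of 1 "2 * t - j"] that by auto
  qed
  have b: "\<exists>q e. (\<forall>i\<in>{2..t - 1}. prime (q i) \<and> odd (e i) \<and> [q i ^ e i = 1] (mod 3 ^ i))
                 \<and> (\<Prod>i\<in>{2..t - 1}. int (q i ^ e i)) dvd m"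
    if "t + 1 \<le> j" "j \<le> 2 * t - 1" "\<not> int p dvd m" "int p ^ j * m \<in> circ_dets (p ^ t)"
      "p = 3" "j = t + 1" for j m
  proof -
    have "t \<ge> 3" using that assms(2) by auto
    then have "{2..t - 1} = {2..<2 + (t - 2)}" by auto
    then show ?thesis using key[OF that(1-4), of 2 "t - 2"] that \<open>t \<ge> 3\<close> by auto
  qed
  have "int p ^ j \<notin> circ_dets (p ^ t)" if j: "t + 1 \<le> j" "j \<le> 2 * t - 1" for j
  proof
    assume "int p ^ j \<in> circ_dets (p ^ t)"
    then have mem: "int p ^ j * 1 \<in> circ_dets (p ^ t)" by simp
    have np: "\<not> int p dvd 1" using prime_gt_1_nat[OF assms(1)] by simp
    \<comment> \<open>At least one prime power must be produced, to contradict m = 1. When p = 3 and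
      j = t + 1 the start s = 2 leaves t - 2 of them, which is positive because t \<ge> 3.\<close>
    have "\<exists>s\<ge>1. (p \<ge> 5 \<or> j > t + 1 \<or> s > 1) \<and> s + j < 2 * t + 1"
    proof (cases "p \<ge> 5 \<or> j > t + 1")
      case True
      then show ?thesis using j by (intro exI[of _ 1]) auto
    next
      case False
      then show ?thesis using assms(2) j by (intro exI[of _ 2]) auto
    qed
    then obtain s where s: "s \<ge> 1" "p \<ge> 5 \<or> j > t + 1 \<or> s > 1" "s + j < 2 * t + 1" by blast
    define k where "k = 2 * t + 1 - (s + j)"
    have k: "k > 0" "s + k + j = 2 * t + 1" using s(3) by (auto simp: k_def)
    obtain q e where qe: "\<forall>i\<in>{s..<s + k}. prime (q i) \<and> odd (e i) \<and> [q i ^ e i = (1::nat)] (mod p ^ i)"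
      "(\<Prod>i\<in>{s..<s + k}. int (q i ^ e i)) dvd 1"
      using key[OF j np mem s(1,2) k(2)] by blast
    have "s \<in> {s..<s + k}" using k(1) by simp
    then have "int (q s ^ e s) dvd (\<Prod>i\<in>{s..<s + k}. int (q i ^ e i))" by (intro dvd_prodI) auto
    then have "int (q s ^ e s) dvd int 1" using qe(2) unfolding of_nat_1 by (rule dvd_trans)
    then have "q s ^ e s = 1" by (simp only: int_dvd_int_iff nat_dvd_1_iff_1)
    moreover have "prime (q s)" "odd (e s)" using qe(1) \<open>s \<in> {s..<s + k}\<close> by auto
    then have "1 < q s ^ e s" by (intro one_less_power prime_gt_1_nat) (auto elim: oddE)
    ultimately show False by linarith
  qed
  then show ?thesis using multiples a b by blast
qed

end
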